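(* Let $\lambda\ge 0$. The following conditions are equivalent. (i) $\lambda\ge 3/2$. (ii) There exists $\omega\in\mathcal A_\lambda^0$ with $|\omega'(0)|=1$. (iii) The set $\{\mu\cdot I:\ \mu\in\mathbb C,\ |\mu|=1\}$ is contained in $\mathcal A_\lambda^0$, where $I(z)=z$ is the identity function. (In particular, $I$ is an admissible dilatation in $\mathcal F_\lambda^0$, i.e. $I\in\mathcal A_\lambda^0$.) (iv) Every automorphism $\sigma$ of the unit disk is an admissible dilatation in $\mathcal F_\lambda$, i.e. $\sigma\in\mathcal A_\lambda$. (v) There exists $\omega\in\mathcal A_\lambda$ with $\|\omega^*\|=1$.
   Context: $\mathbb D$ is the open unit disk in $\mathbb C$; automorphisms of the disk are its conformal (biholomorphic) self-maps. A harmonic mapping $f$ in $\mathbb D$ is a complex-valued harmonic function; it has a canonical decomposition $f=h+\overline g$ with $h,g$ analytic in $\mathbb D$. It is (locally univalent and) sense-preserving if and only if $h'$ does not vanish and the dilatation $\omega=g'/h'$ satisfies $|\omega|<1$ in $\mathbb D$. For a locally univalent analytic function $h$, $Sh=(h''/h')'-\frac12(h''/h')^2$. For a sense-preserving harmonic mapping $f=h+\overline g$ in $\mathbb D$ with dilatation $\omega$, the Schwarzian derivative is $$S_f=Sh+\frac{\overline\omega}{1-|\omega|^2}\left(\frac{h''}{h'}\,\omega'-\omega''\right)-\frac32\left(\frac{\omega'\,\overline\omega}{1-|\omega|^2}\right)^2,$$ and the Schwarzian norm is $\|S_f\|=\sup_{z\in\mathbb D}|S_f(z)|(1-|z|^2)^2$.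 $\mathcal F_\lambda$ is the family of sense-preserving harmonic mappings $f=h+\overline g$ in $\mathbb D$ with $h(0)=g(0)=0$, $h'(0)=1$ and $\|S_f\|\le\lambda$; $\mathcal F_\lambda^0=\{f=h+\overline g\in\mathcal F_\lambda: g'(0)=0\}$. The set of admissible dilatations $\mathcal A_\lambda$ (resp. $\mathcal A_\lambda^0$) is the set of dilatations $\omega=g'/h'$ of functions $f=h+\overline g$ in $\mathcal F_\lambda$ (resp. $\mathcal F_\lambda^0$). For an analytic $\omega:\mathbb D\to\mathbb D$, the hyperbolic derivative is $\omega^*(z)=\frac{\omega'(z)(1-|z|^2)}{1-|\omega(z)|^2}$ and the hyperbolic norm is $\|\omega^*\|=\sup_{z\in\mathbb D}|\omega^*(z)|$. *)

theory Defs
  imports "HOL-Complex_Analysis.Complex_Analysis"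
begin

abbreviation unit_disk :: "complex set"
  where "unit_disk \<equiv> ball 0 1"

text \<open>
  A harmonic mapping of the (simply connected) unit disk is a function \<open>f = h + cnj g\<close> on the
  disk with \<open>h\<close> and \<open>g\<close> analytic there. The functions \<open>h\<close> and \<open>g\<close> are determined on the disk by
  \<open>f\<close> up to additive constants, so \<open>deriv h\<close> and \<open>deriv g\<close> depend only on \<open>f\<close>.
\<close>

definition harmonic_decomposition ::
    "(complex \<Rightarrow> complex) \<Rightarrow> (complex \<Rightarrow> complex) \<Rightarrow> (complex \<Rightarrow> complex) \<Rightarrow> bool"
  where "harmonic_decomposition f h g \<longleftrightarrow>
    h holomorphic_on unit_disk \<and> g holomorphic_on unit_disk \<and>
    (\<forall>z\<in>unit_disk. f z = h z + cnj (g z))"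

definition dilatation :: "(complex \<Rightarrow> complex) \<Rightarrow> (complex \<Rightarrow> complex) \<Rightarrow> complex \<Rightarrow> complex"
  where "dilatation h g z = deriv g z / deriv h z"

text \<open>
  Local univalence is included: since the Jacobian of \<open>h + cnj g\<close> is
  \<open>(cmod (deriv h z))\<^sup>2 - (cmod (deriv g z))\<^sup>2\<close>, the condition says that it is positive on the disk.
\<close>

definition sense_preserving :: "(complex \<Rightarrow> complex) \<Rightarrow> (complex \<Rightarrow> complex) \<Rightarrow> bool"
  where "sense_preserving h g \<longleftrightarrow>
    (\<forall>z\<in>unit_disk. deriv h z \<noteq> 0 \<and> cmod (dilatation h g z) < 1)"

definition pre_schwarzian :: "(complex \<Rightarrow> complex) \<Rightarrow> complex \<Rightarrow> complex"
  where "pre_schwarzian h z = deriv (deriv h) z / deriv h z"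

definition schwarzian :: "(complex \<Rightarrow> complex) \<Rightarrow> complex \<Rightarrow> complex"
  where "schwarzian h z = deriv (pre_schwarzian h) z - 1 / 2 * (pre_schwarzian h z)\<^sup>2"

definition harmonic_schwarzian ::
    "(complex \<Rightarrow> complex) \<Rightarrow> (complex \<Rightarrow> complex) \<Rightarrow> complex \<Rightarrow> complex"
  where "harmonic_schwarzian h g z =
    (let \<omega> = dilatation h g; d = complex_of_real (1 - (cmod (\<omega> z))\<^sup>2) in
      schwarzian h z
      + cnj (\<omega> z) / d * (pre_schwarzian h z * deriv \<omega> z - deriv (deriv \<omega>) z)
      - 3 / 2 * (deriv \<omega> z * cnj (\<omega> z) / d)\<^sup>2)"

text \<open>
  Suprema are taken in the extended reals, so that an unbounded Schwarzian has norm \<open>\<infinity>\<close>.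
\<close>

definition schwarzian_norm :: "(complex \<Rightarrow> complex) \<Rightarrow> (complex \<Rightarrow> complex) \<Rightarrow> ereal"
  where "schwarzian_norm h g =
    (SUP z\<in>unit_disk. ereal (cmod (harmonic_schwarzian h g z) * (1 - (cmod z)\<^sup>2)\<^sup>2))"

definition harmonic_family :: "real \<Rightarrow> (complex \<Rightarrow> complex) set"
  where "harmonic_family L = {f. \<exists>h g. harmonic_decomposition f h g \<and> sense_preserving h g \<and>
    h 0 = 0 \<and> g 0 = 0 \<and> deriv h 0 = 1 \<and> schwarzian_norm h g \<le> ereal L}"

definition harmonic_family0 :: "real \<Rightarrow> (complex \<Rightarrow> complex) set"
  where "harmonic_family0 L =
    {f \<in> harmonic_family L. \<exists>h g. harmonic_decomposition f h g \<and> deriv g 0 = 0}"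

text \<open>
  Functions are total, so a dilatation is specified only by its values on the disk.
\<close>

definition dilatations :: "(complex \<Rightarrow> complex) set \<Rightarrow> (complex \<Rightarrow> complex) set"
  where "dilatations F = {\<omega>. \<exists>f\<in>F. \<exists>h g. harmonic_decomposition f h g \<and>
    (\<forall>z\<in>unit_disk. \<omega> z = dilatation h g z)}"

definition admissible_dilatations :: "real \<Rightarrow> (complex \<Rightarrow> complex) set"
  where "admissible_dilatations L = dilatations (harmonic_family L)"

definition admissible_dilatations0 :: "real \<Rightarrow> (complex \<Rightarrow> complex) set"
  where "admissible_dilatations0 L = dilatations (harmonic_family0 L)"

definition hyperbolic_deriv :: "(complex \<Rightarrow> complex) \<Rightarrow> complex \<Rightarrow> complex"
  where "hyperbolic_deriv \<omega> z =
    deriv \<omega> z * complex_of_real (1 - (cmod z)\<^sup>2) / complex_of_real (1 - (cmod (\<omega> z))\<^sup>2)"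

definition hyperbolic_norm :: "(complex \<Rightarrow> complex) \<Rightarrow> ereal"
  where "hyperbolic_norm \<omega> = (SUP z\<in>unit_disk. ereal (cmod (hyperbolic_deriv \<omega> z)))"

definition disk_automorphism :: "(complex \<Rightarrow> complex) \<Rightarrow> bool"
  where "disk_automorphism \<sigma> \<longleftrightarrow> \<sigma> holomorphic_on unit_disk \<and>
    bij_betw \<sigma> unit_disk unit_disk \<and> inv_into unit_disk \<sigma> holomorphic_on unit_disk"

end

theory Submission
  imports Defs
begin

text \<open>
  The threshold \<open>3/2\<close> is the Schwarzian norm of \<open>f = z + cnj (z\<^sup>2/2)\<close>, whose dilatation is the
  identity. More generally, let \<open>\<sigma>\<close> be a Moebius automorphism of the disk and take, up to
  constants,
  \<open>h = \<sigma>\<close>, \<open>g = \<sigma>\<^sup>2/2\<close>. The dilatation is \<open>\<sigma>\<close>, the Schwarzian of \<open>h\<close> vanishes, the middle term of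
  the harmonic Schwarzian cancels because \<open>h'\<close> is proportional to the derivative of the dilatation, and
  the last term has modulus \<open>3/2 \<cdot> \<bar>\<sigma>\<bar>\<^sup>2 / (1 - \<bar>z\<bar>\<^sup>2)\<^sup>2\<close>. So \<open>L \<ge> 3/2\<close> makes every automorphism
  admissible (\<open>Moebius_admissible\<close>), and rotations are admissible with \<open>g'(0) = 0\<close>.

  All converses follow from one statement (\<open>three_halves_le_schwarzian_bound\<close>): if the hyperbolic
  derivative \<open>\<omega>\<^sup>*\<close> of the dilatation comes arbitrarily close to \<open>1\<close> in modulus, then \<open>L \<ge> 3/2\<close>. Fix
  a point \<open>z0\<close> with \<open>\<bar>\<omega>\<^sup>*(z0)\<bar>\<close> close to \<open>1\<close>. Replacing \<open>f\<close> by \<open>f - cnj a \<cdot> cnj f\<close> with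
  \<open>a = \<omega>(z0)\<close> leaves the Schwarzian unchanged (\<open>harmonic_schwarzian_affine\<close>) and gives \<open>\<omega>(z0) = 0\<close>.
  On a level curve \<open>\<bar>\<omega>\<bar> = \<rho>\<close> the non-holomorphic factor of the Schwarzian satisfies
  \<open>\<omega> \<cdot> cnj \<omega> / (1 - \<bar>\<omega>\<bar>\<^sup>2) = k\<close> with the constant \<open>k = \<rho>\<^sup>2 / (1 - \<rho>\<^sup>2)\<close>. Hence with \<open>p = h''/h'\<close>
  the product \<open>(\<omega>/\<omega>')\<^sup>2 S\<^sub>f\<close> agrees there with the holomorphic function
  \<open>G = (\<omega>/\<omega>')\<^sup>2 (p' - p\<^sup>2/2) + k \<omega> (p \<omega>' - \<omega>'') / \<omega>'\<^sup>2 - 3/2 \<cdot> k\<^sup>2\<close>,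
  whose value at \<open>z0\<close> is \<open>-3/2 k\<^sup>2\<close>. The maximum principle, applied
  to the part of \<open>{\<bar>\<omega>\<bar> < \<rho>}\<close> in a pseudo-hyperbolic disk about \<open>z0\<close>, gives
  \<open>3/2 \<cdot> \<rho>\<^sup>2 \<cdot> min \<bar>\<omega>\<^sup>*\<bar>\<^sup>2 \<le> L\<close> (\<open>schwarzian_bound_level_curve\<close>). It remains to see that
  \<open>\<bar>\<omega>\<^sup>*\<bar>\<close> stays close to \<open>1\<close> on the whole pseudo-hyperbolic disk, which is a consequence of the
  Schwarz--Pick lemma (\<open>hyperbolic_deriv_near_zero\<close>). Letting \<open>\<bar>\<omega>\<^sup>*(z0)\<bar>\<close> and then \<open>\<rho>\<close> tend to
  \<open>1\<close> finishes the argument. The conditions on \<open>\<omega>'(0)\<close> and on \<open>\<parallel>\<omega>\<^sup>*\<parallel>\<close> supply such points directly; the other two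
  make the identity admissible, for which \<open>\<bar>\<omega>\<^sup>*\<bar> = 1\<close> everywhere.
\<close>

section \<open>Moebius maps and the Schwarz--Pick lemma\<close>

text \<open>
  The form in which first and second derivatives are computed below: the differentiated function
  is known by a formula on the disk only, and its values elsewhere do not matter.
\<close>

lemma deriv_eq_on_disk:
  assumes "\<And>w. w \<in> unit_disk \<Longrightarrow> f w = F w" and "(F has_field_derivative D) (at z)" and "z \<in> unit_disk"
  shows "deriv f z = D"
proof (rule DERIV_imp_deriv)
  show "(f has_field_derivative D) (at z)"
    by (rule has_field_derivative_transform_within_open[OF assms(2) open_ball assms(3)])
       (use assms(1) in auto)
qed

lemma one_minus_cnj_mult_nonzero:
  assumes "cmod a < 1" "cmod z \<le> 1"
  shows "1 - cnj a * z \<noteq> 0"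
proof
  assume "1 - cnj a * z = 0"
  hence "cmod (cnj a * z) = 1" by simp
  hence "cmod a * cmod z = 1" by (simp add: norm_mult)
  moreover have "cmod a * cmod z \<le> cmod a * 1"
    by (rule mult_left_mono) (use assms in auto)
  ultimately show False using assms by simp
qed

text \<open>
  In this undivided form the identity also covers boundary points, where it shows that a Moebius
  automorphism maps the unit circle into itself.
\<close>

lemma norm_pseudo_hyperbolic_identity:
  "(cmod (1 - cnj a * z))\<^sup>2 - (cmod (z - a))\<^sup>2 = (1 - (cmod a)\<^sup>2) * (1 - (cmod z)\<^sup>2)"
  unfolding cmod_power2 by (simp add: algebra_simps power2_eq_square)

lemma one_minus_norm_Moebius:
  assumes "cmod a < 1" "cmod z < 1"
  shows "1 - (cmod (Moebius_function 0 a z))\<^sup>2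
           = (1 - (cmod a)\<^sup>2) * (1 - (cmod z)\<^sup>2) / (cmod (1 - cnj a * z))\<^sup>2"
proof -
  have "(cmod (1 - cnj a * z))\<^sup>2 \<noteq> 0"
    using one_minus_cnj_mult_nonzero[of a z] assms by simp
  thus ?thesis
    unfolding Moebius_function_simple norm_divide power_divide
      norm_pseudo_hyperbolic_identity[of a z, symmetric]
    by (simp add: field_simps)
qed

lemma Moebius_function_has_field_derivative:
  assumes "cmod a < 1" "cmod z < 1"
  shows "(Moebius_function 0 a has_field_derivative
           complex_of_real (1 - (cmod a)\<^sup>2) / (1 - cnj a * z)\<^sup>2) (at z)"
proof -
  have nz: "1 - cnj a * z \<noteq> 0"
    using one_minus_cnj_mult_nonzero[of a z] assms by simp
  have "((\<lambda>z. (z - a) / (1 - cnj a * z)) has_field_derivative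
      (1 * (1 - cnj a * z) - (z - a) * (- cnj a)) / ((1 - cnj a * z) * (1 - cnj a * z))) (at z)"
    by (rule derivative_eq_intros refl nz | simp)+
  also have "(1 * (1 - cnj a * z) - (z - a) * (- cnj a)) / ((1 - cnj a * z) * (1 - cnj a * z))
      = complex_of_real (1 - (cmod a)\<^sup>2) / (1 - cnj a * z)\<^sup>2"
  proof -
    have "complex_of_real (1 - (cmod a)\<^sup>2) = 1 - a * cnj a"
      using complex_norm_square[of a] by simp
    thus ?thesis by (simp only: power2_eq_square) (simp add: algebra_simps)
  qed
  finally show ?thesis
    by (simp add: Moebius_function_def[abs_def])
qed

text \<open>
  Moebius automorphisms are isometries of the hyperbolic metric: equality in the Schwarz--Pick lemma.
\<close>

lemma norm_deriv_Moebius: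
  assumes "cmod a < 1" "cmod z < 1"
  shows "cmod (deriv (Moebius_function 0 a) z) * (1 - (cmod z)\<^sup>2) = 1 - (cmod (Moebius_function 0 a z))\<^sup>2"
proof -
  have "\<bar>1 - (cmod a)\<^sup>2\<bar> = 1 - (cmod a)\<^sup>2"
    using assms(1) by (simp add: power_le_one)
  hence "cmod (complex_of_real (1 - (cmod a)\<^sup>2)) = 1 - (cmod a)\<^sup>2"
    by (simp only: norm_of_real)
  thus ?thesis
    unfolding one_minus_norm_Moebius[OF assms]
      DERIV_imp_deriv[OF Moebius_function_has_field_derivative[OF assms]] norm_divide norm_power
    by simp
qed

text \<open>
  Move \<open>w\<close> and \<open>g w\<close> to the origin by Moebius automorphisms and apply the Schwarz lemma. The estimates
  are stated without division so that they carry over to values on the unit circle.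
\<close>

lemma Schwarz_Pick_open:
  assumes hol: "g holomorphic_on unit_disk" and lt: "\<And>z. z \<in> unit_disk \<Longrightarrow> cmod (g z) < 1"
    and w: "w \<in> unit_disk" and z: "z \<in> unit_disk"
  shows "cmod (g z - g w) \<le> cmod (Moebius_function 0 w z) * cmod (1 - cnj (g w) * g z)"
    and "cmod (deriv g w) * (1 - (cmod w)\<^sup>2) \<le> 1 - (cmod (g w))\<^sup>2"
proof -
  define f where "f = Moebius_function 0 (g w) \<circ> (g \<circ> Moebius_function 0 (-w))"
  have w1: "cmod w < 1" "cmod (-w) < 1" and z1: "cmod z < 1" and gw: "cmod (g w) < 1" and gz: "cmod (g z) < 1"
    using w z lt by auto
  have m0: "Moebius_function 0 (-w) 0 = w"
    by (simp add: Moebius_function_of_zero)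
  have f0: "f 0 = 0"
    by (simp add: f_def m0 Moebius_function_eq_zero)
  have holf: "f holomorphic_on ball 0 1"
    unfolding f_def
    by (intro holomorphic_on_compose_gen[where t = "ball 0 1"] Moebius_function_holomorphic hol)
       (use w1 gw lt Moebius_function_norm_lt_1 in auto)
  have no: "cmod (f u) < 1" if "cmod u < 1" for u
    unfolding f_def o_def by (intro Moebius_function_norm_lt_1 gw) (use lt Moebius_function_norm_lt_1 w1 that in auto)
  have "f (Moebius_function 0 w z) = Moebius_function 0 (g w) (g z)"
    using Moebius_function_compose[of "-w" w z] w1 z1 by (simp add: f_def)
  moreover have "cmod (f (Moebius_function 0 w z)) \<le> cmod (Moebius_function 0 w z)"
    using Schwarz_Lemma(1)[OF holf f0 no] Moebius_function_norm_lt_1 w1 z1 by blast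
  ultimately have "cmod (g z - g w) / cmod (1 - cnj (g w) * g z) \<le> cmod (Moebius_function 0 w z)"
    by (simp add: Moebius_function_simple norm_divide)
  moreover have "cmod (1 - cnj (g w) * g z) > 0"
    using one_minus_cnj_mult_nonzero[of "g w" "g z"] gw gz by simp
  ultimately show "cmod (g z - g w) \<le> cmod (Moebius_function 0 w z) * cmod (1 - cnj (g w) * g z)"
    by (simp add: divide_le_eq)
  have pos: "0 < 1 - (cmod w)\<^sup>2" "0 < 1 - (cmod (g w))\<^sup>2"
    using w1 gw by (auto simp: power_less_one_iff abs_square_less_1)
  have d1: "(Moebius_function 0 (-w) has_field_derivative complex_of_real (1 - (cmod w)\<^sup>2)) (at 0)"
    using Moebius_function_has_field_derivative[of "-w" 0] w1 by simp
  have d2: "(g has_field_derivative deriv g w) (at w)"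
    using hol w by (meson holomorphic_derivI open_ball)
  have d12: "(g \<circ> Moebius_function 0 (-w) has_field_derivative deriv g w * complex_of_real (1 - (cmod w)\<^sup>2)) (at 0)"
    by (rule DERIV_chain) (use d1 d2 m0 in auto)
  have "1 - cnj (g w) * g w = complex_of_real (1 - (cmod (g w))\<^sup>2)"
    using complex_norm_square[of "g w"] by (simp add: mult.commute)
  hence d3: "(Moebius_function 0 (g w) has_field_derivative 1 / complex_of_real (1 - (cmod (g w))\<^sup>2)) (at (g w))"
    using Moebius_function_has_field_derivative[of "g w" "g w"] gw pos
    by (simp add: power2_eq_square del: of_real_diff)
  have "(f has_field_derivative 1 / complex_of_real (1 - (cmod (g w))\<^sup>2) * (deriv g w * complex_of_real (1 - (cmod w)\<^sup>2))) (at 0)"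
    unfolding f_def by (rule DERIV_chain) (use d12 d3 m0 in auto)
  hence "deriv f 0 = 1 / complex_of_real (1 - (cmod (g w))\<^sup>2) * (deriv g w * complex_of_real (1 - (cmod w)\<^sup>2))"
    by (rule DERIV_imp_deriv)
  moreover have "cmod (deriv f 0) \<le> 1"
    using Schwarz_Lemma(2)[OF holf f0 no, of 0] by simp
  ultimately have "1 / (1 - (cmod (g w))\<^sup>2) * (cmod (deriv g w) * (1 - (cmod w)\<^sup>2)) \<le> 1"
    using pos by (simp add: norm_mult norm_divide abs_of_pos del: of_real_diff)
  thus "cmod (deriv g w) * (1 - (cmod w)\<^sup>2) \<le> 1 - (cmod (g w))\<^sup>2"
    using pos by (simp add: divide_le_eq)
qed

text \<open>
  The closed disk has to be allowed as target because the quotient of a self-map of the disk by a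
  Moebius map, as in \<open>hyperbolic_deriv_near_zero\<close>, can be a unimodular constant.
\<close>

lemma Schwarz_Pick:
  assumes hol: "g holomorphic_on unit_disk" and le: "\<And>z. z \<in> unit_disk \<Longrightarrow> cmod (g z) \<le> 1"
    and w: "w \<in> unit_disk" and z: "z \<in> unit_disk"
  shows "cmod (g z - g w) \<le> cmod (Moebius_function 0 w z) * cmod (1 - cnj (g w) * g z)"
    and "cmod (deriv g w) * (1 - (cmod w)\<^sup>2) \<le> 1 - (cmod (g w))\<^sup>2"
proof -
  have "cmod (g z - g w) \<le> cmod (Moebius_function 0 w z) * cmod (1 - cnj (g w) * g z) \<and>
      cmod (deriv g w) * (1 - (cmod w)\<^sup>2) \<le> 1 - (cmod (g w))\<^sup>2"
  proof (cases "\<forall>z\<in>unit_disk. cmod (g z) < 1")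
    case True
    thus ?thesis using Schwarz_Pick_open[OF hol _ w z] by blast
  next
    \<comment> \<open>A value on the unit circle forces \<open>g\<close> to be constant by the maximum modulus principle.\<close>
    case False
    then obtain u where u: "u \<in> unit_disk" "cmod (g u) = 1"
      using le by force
    have "g constant_on unit_disk"
      by (rule maximum_modulus_principle[OF hol, where U = unit_disk and \<xi> = u]) (use u le in auto)
    then obtain c where c: "\<And>z. z \<in> unit_disk \<Longrightarrow> g z = c"
      by (auto simp: constant_on_def)
    have "deriv g w = 0"
      by (rule deriv_eq_on_disk[OF c _ w]) auto
    thus ?thesis using c[OF w] c[OF z] le[OF w] by (simp add: power_le_one)
  qed
  thus "cmod (g z - g w) \<le> cmod (Moebius_function 0 w z) * cmod (1 - cnj (g w) * g z)"
    and "cmod (deriv g w) * (1 - (cmod w)\<^sup>2) \<le> 1 - (cmod (g w))\<^sup>2" by blast+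
qed

section \<open>The hyperbolic derivative\<close>

lemma cmod_hyperbolic_deriv:
  assumes "cmod z < 1" "cmod (\<omega> z) < 1"
  shows "cmod (hyperbolic_deriv \<omega> z) = cmod (deriv \<omega> z) * (1 - (cmod z)\<^sup>2) / (1 - (cmod (\<omega> z))\<^sup>2)"
proof -
  have "0 < 1 - (cmod z)\<^sup>2" "0 < 1 - (cmod (\<omega> z))\<^sup>2"
    using assms by (auto simp: abs_square_less_1)
  thus ?thesis
    unfolding hyperbolic_deriv_def norm_mult norm_divide norm_of_real by simp
qed

lemma hyperbolic_deriv_le_1:
  assumes hol: "\<omega> holomorphic_on unit_disk" and lt: "\<And>z. z \<in> unit_disk \<Longrightarrow> cmod (\<omega> z) < 1"
    and z: "z \<in> unit_disk"
  shows "cmod (hyperbolic_deriv \<omega> z) \<le> 1"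
proof -
  have "cmod (deriv \<omega> z) * (1 - (cmod z)\<^sup>2) \<le> 1 - (cmod (\<omega> z))\<^sup>2"
    by (rule Schwarz_Pick_open(2)[OF hol lt z z])
  moreover have "0 < 1 - (cmod (\<omega> z))\<^sup>2" using lt[OF z] by (simp add: abs_square_less_1)
  moreover have "cmod z < 1" using z by simp
  ultimately show ?thesis using cmod_hyperbolic_deriv[of z \<omega>] lt[OF z] by simp
qed

text \<open>
  The chain rule together with the invariance of the hyperbolic metric under Moebius maps.
\<close>

lemma hyperbolic_deriv_Moebius_compose:
  assumes hol: "\<omega> holomorphic_on unit_disk" and lt: "\<And>z. z \<in> unit_disk \<Longrightarrow> cmod (\<omega> z) < 1"
    and eq: "\<And>z. z \<in> unit_disk \<Longrightarrow> \<omega>1 z = Moebius_function 0 a (\<omega> z)"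
    and a: "cmod a < 1" and z: "z \<in> unit_disk"
  shows "cmod (hyperbolic_deriv \<omega>1 z) = cmod (hyperbolic_deriv \<omega> z)"
proof -
  let ?M = "Moebius_function 0 a"
  have "(?M has_field_derivative deriv ?M (\<omega> z)) (at (\<omega> z))"
    using Moebius_function_has_field_derivative[OF a lt[OF z]] DERIV_imp_deriv by metis
  moreover have "(\<omega> has_field_derivative deriv \<omega> z) (at z)"
    using hol z by (meson holomorphic_derivI open_ball)
  ultimately have "(?M \<circ> \<omega> has_field_derivative deriv ?M (\<omega> z) * deriv \<omega> z) (at z)"
    by (rule DERIV_chain)
  hence d: "deriv \<omega>1 z = deriv ?M (\<omega> z) * deriv \<omega> z"
    using eq by (intro deriv_eq_on_disk[OF _ _ z]) auto
  have M1: "cmod (?M (\<omega> z)) < 1"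
    using Moebius_function_norm_lt_1[OF a lt[OF z]] .
  have p: "0 < 1 - (cmod (?M (\<omega> z)))\<^sup>2" "0 < 1 - (cmod (\<omega> z))\<^sup>2"
    using M1 lt[OF z] by (auto simp: abs_square_less_1)
  have "cmod (deriv ?M (\<omega> z)) = (1 - (cmod (?M (\<omega> z)))\<^sup>2) / (1 - (cmod (\<omega> z))\<^sup>2)"
    using norm_deriv_Moebius[OF a lt[OF z]] p by (simp add: eq_divide_eq)
  moreover have "cmod z < 1" using z by simp
  ultimately show ?thesis
    using cmod_hyperbolic_deriv[of z \<omega>1] cmod_hyperbolic_deriv[of z \<omega>] p M1 lt[OF z] eq[OF z]
    by (simp add: d norm_mult)
qed

text \<open>
  If \<open>\<bar>\<omega>\<^sup>*\<bar>\<close> is nearly \<open>1\<close> at a zero of \<open>\<omega>\<close>, it remains so at bounded hyperbolic distance.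
  Factor \<open>\<omega> = \<tau> g\<close> with \<open>\<tau>\<close> the Moebius map vanishing at \<open>z0\<close>; then \<open>\<bar>g z0\<bar> = \<bar>\<omega>\<^sup>*(z0)\<bar>\<close>. The
  Schwarz--Pick lemma for \<open>g\<close> bounds \<open>s = \<bar>g z\<bar>\<close> below by \<open>(s0 - t) / (1 - t s0)\<close>, and its
  infinitesimal form bounds the term \<open>\<tau> g'\<close> of the derivative \<open>\<tau>' g + \<tau> g'\<close>, which
  gives \<open>\<bar>\<omega>\<^sup>*(z)\<bar> \<ge> (s - t) / (1 - t s)\<close>.
\<close>

lemma hyperbolic_deriv_near_zero:
  assumes hol: "\<omega> holomorphic_on unit_disk" and lt: "\<And>z. z \<in> unit_disk \<Longrightarrow> cmod (\<omega> z) < 1"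
    and z0: "z0 \<in> unit_disk" and zero: "\<omega> z0 = 0" and z: "z \<in> unit_disk"
  defines "t \<equiv> cmod (Moebius_function 0 z0 z)"
  defines "s0 \<equiv> cmod (hyperbolic_deriv \<omega> z0)"
  obtains s where "0 \<le> s" "s \<le> 1" "cmod (\<omega> z) = t * s" "s0 - t \<le> s * (1 - t * s0)"
    "s - t \<le> cmod (hyperbolic_deriv \<omega> z) * (1 - t * s)"
proof -
  let ?\<tau> = "Moebius_function 0 z0" and ?\<phi> = "Moebius_function 0 (- z0)"
  have z01: "cmod z0 < 1" "cmod (-z0) < 1" and z1: "cmod z < 1"
    using z0 z by auto
  have \<tau>0: "?\<phi> 0 = z0" by (simp add: Moebius_function_of_zero)
  have \<tau>D: "?\<tau> u \<in> unit_disk" if "u \<in> unit_disk" for u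
    using that z01 Moebius_function_norm_lt_1 by auto
  have holv: "(\<omega> \<circ> ?\<phi>) holomorphic_on ball 0 1"
    by (intro holomorphic_on_compose_gen[where t = "ball 0 1"] Moebius_function_holomorphic hol)
       (use z01 Moebius_function_norm_lt_1 in auto)
  have v0: "(\<omega> \<circ> ?\<phi>) 0 = 0" by (simp add: \<tau>0 zero)
  have nov: "cmod ((\<omega> \<circ> ?\<phi>) u) < 1" if "cmod u < 1" for u
    using that z01 Moebius_function_norm_lt_1 by (auto intro!: lt)
  obtain k where k: "k holomorphic_on ball 0 1" "\<And>u. cmod u < 1 \<Longrightarrow> (\<omega> \<circ> ?\<phi>) u = u * k u"
      "deriv (\<omega> \<circ> ?\<phi>) 0 = k 0"
    using Schwarz3[OF holv v0] by blast
  have k1: "cmod (k u) \<le> 1" if "cmod u < 1" for u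
  proof (cases "u = 0")
    case True
    have "cmod (deriv (\<omega> \<circ> ?\<phi>) 0) \<le> 1"
      by (rule Schwarz_Lemma(2)[OF holv v0 nov, of 0]) auto
    thus ?thesis using k(3) True by simp
  next
    case False
    have "cmod (u * k u) \<le> cmod u"
      using Schwarz_Lemma(1)[OF holv v0 nov that] k(2)[OF that] by simp
    thus ?thesis using False by (simp add: norm_mult mult_le_cancel_left2)
  qed
  define g where "g = k \<circ> ?\<tau>"
  have holg: "g holomorphic_on unit_disk"
    unfolding g_def
    by (intro holomorphic_on_compose_gen[where t = "ball 0 1"] Moebius_function_holomorphic k(1))
       (use z01 Moebius_function_norm_lt_1 in auto)
  have g1: "cmod (g u) \<le> 1" if "u \<in> unit_disk" for u
    using k1 \<tau>D[OF that] by (simp add: g_def)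
  have fac: "\<omega> u = ?\<tau> u * g u" if "u \<in> unit_disk" for u
    using k(2)[of "?\<tau> u"] \<tau>D[OF that] Moebius_function_compose[of "-z0" z0 u] that z01
    by (simp add: g_def)
  have der: "deriv \<omega> u = deriv ?\<tau> u * g u + deriv g u * ?\<tau> u" if u: "u \<in> unit_disk" for u
  proof (rule deriv_eq_on_disk[OF fac _ u])
    have "(?\<tau> has_field_derivative deriv ?\<tau> u) (at u)" "(g has_field_derivative deriv g u) (at u)"
      using holomorphic_derivI[OF Moebius_function_holomorphic[OF z01(1)] open_ball u]
        holomorphic_derivI[OF holg open_ball u] by auto
    thus "((\<lambda>u. ?\<tau> u * g u) has_field_derivative deriv ?\<tau> u * g u + deriv g u * ?\<tau> u) (at u)"
      by (rule DERIV_mult)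
  qed auto
  define s where "s = cmod (g z)"
  have s01: "0 \<le> s" "s \<le> 1" using g1[OF z] by (auto simp: s_def)
  have t01: "0 \<le> t" "t < 1" using \<tau>D[OF z] by (auto simp: t_def)
  have ts: "t * s < 1" using s01 t01
    by (meson le_less_trans mult_left_le)
  have "cmod (\<omega> z) = t * s" using fac[OF z] by (simp add: t_def s_def norm_mult)
  \<comment> \<open>The second summand of the derivative vanishes at \<open>z0\<close>, and \<open>\<tau>\<close> is a hyperbolic isometry.\<close>
  have s0: "s0 = cmod (g z0)"
  proof -
    have "cmod (deriv ?\<tau> z0) * (1 - (cmod z0)\<^sup>2) = 1"
      using norm_deriv_Moebius[OF z01(1) z01(1)] by (simp add: Moebius_function_eq_zero)
    thus ?thesis
      using der[OF z0] zero z01 unfolding s0_def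
      by (simp add: cmod_hyperbolic_deriv Moebius_function_eq_zero norm_mult mult.commute mult.left_commute)
  qed
  have "s0 - t \<le> s * (1 - t * s0)"
  proof -
    have s0': "0 \<le> s0" "s0 \<le> 1" using g1[OF z0] s0 by auto
    \<comment> \<open>Estimating \<open>1 - cnj (g z0) * g z\<close> by its distance from \<open>1 - \<bar>g z0\<bar>\<^sup>2\<close> turns the Schwarz--Pick
      inequality into a bound on \<open>\<bar>g z - g z0\<bar>\<close> alone.\<close>
    have "1 - cnj (g z0) * g z = complex_of_real (1 - s0\<^sup>2) - cnj (g z0) * (g z - g z0)"
      using complex_norm_square[of "g z0"] by (simp add: s0 algebra_simps)
    hence "cmod (1 - cnj (g z0) * g z) \<le> cmod (complex_of_real (1 - s0\<^sup>2)) + cmod (cnj (g z0) * (g z - g z0))"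
      by (metis norm_triangle_ineq4)
    also have "\<dots> = (1 - s0\<^sup>2) + s0 * cmod (g z - g z0)"
    proof -
      have "\<bar>1 - s0\<^sup>2\<bar> = 1 - s0\<^sup>2" using s0' by (simp add: power_le_one)
      thus ?thesis unfolding norm_of_real norm_mult complex_mod_cnj s0 by simp
    qed
    finally have a: "cmod (1 - cnj (g z0) * g z) \<le> (1 - s0\<^sup>2) + s0 * cmod (g z - g z0)" .
    have "cmod (g z - g z0) \<le> t * cmod (1 - cnj (g z0) * g z)"
      unfolding t_def by (rule Schwarz_Pick(1)[OF holg g1 z0 z])
    also have "\<dots> \<le> t * ((1 - s0\<^sup>2) + s0 * cmod (g z - g z0))"
      by (rule mult_left_mono[OF a t01(1)])
    finally have b: "cmod (g z - g z0) * (1 - t * s0) \<le> t * (1 - s0\<^sup>2)"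
      by (simp add: algebra_simps)
    have "t * s0 < 1" using s0' t01 by (meson le_less_trans mult_left_le)
    moreover have "s0 - s \<le> cmod (g z - g z0)"
      unfolding s0 s_def using norm_triangle_ineq3[of "g z" "g z0"] by linarith
    ultimately have "(s0 - s) * (1 - t * s0) \<le> cmod (g z - g z0) * (1 - t * s0)"
      by (intro mult_right_mono) auto
    also note b
    finally show ?thesis by (simp add: algebra_simps power2_eq_square)
  qed
  have "s - t \<le> cmod (hyperbolic_deriv \<omega> z) * (1 - t * s)"
  proof -
    have pz: "0 < 1 - (cmod z)\<^sup>2" using z1 by (simp add: abs_square_less_1)
    have "cmod (deriv ?\<tau> z) * s - cmod (deriv g z) * t \<le> cmod (deriv \<omega> z)"
      unfolding der[OF z] s_def t_def norm_mult[symmetric]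
      using norm_diff_ineq[of "deriv ?\<tau> z * g z" "deriv g z * ?\<tau> z"] by simp
    hence "(cmod (deriv ?\<tau> z) * s - cmod (deriv g z) * t) * (1 - (cmod z)\<^sup>2) \<le> cmod (deriv \<omega> z) * (1 - (cmod z)\<^sup>2)"
      by (rule mult_right_mono) (use pz in auto)
    moreover have "cmod (deriv ?\<tau> z) * (1 - (cmod z)\<^sup>2) = 1 - t\<^sup>2"
      using norm_deriv_Moebius[OF z01(1) z1] by (simp add: t_def)
    moreover have "t * (cmod (deriv g z) * (1 - (cmod z)\<^sup>2)) \<le> t * (1 - s\<^sup>2)"
      using Schwarz_Pick(2)[OF holg g1 z z] t01 unfolding s_def by (intro mult_left_mono)
    moreover have "(cmod (deriv ?\<tau> z) * s - cmod (deriv g z) * t) * (1 - (cmod z)\<^sup>2)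
        = s * (cmod (deriv ?\<tau> z) * (1 - (cmod z)\<^sup>2)) - t * (cmod (deriv g z) * (1 - (cmod z)\<^sup>2))"
      by (simp add: algebra_simps)
    ultimately have "s * (1 - t\<^sup>2) - t * (1 - s\<^sup>2) \<le> cmod (deriv \<omega> z) * (1 - (cmod z)\<^sup>2)"
      by simp
    moreover have "cmod (deriv \<omega> z) * (1 - (cmod z)\<^sup>2) = cmod (hyperbolic_deriv \<omega> z) * (1 - (t * s)\<^sup>2)"
    proof -
      have "(t * s)\<^sup>2 < 1" using ts t01 s01 by (simp add: abs_square_less_1)
      thus ?thesis
        using cmod_hyperbolic_deriv[of z \<omega>, OF z1 lt[OF z]] \<open>cmod (\<omega> z) = t * s\<close> by simp
    qed
    \<comment> \<open>\<open>s (1 - t\<^sup>2) - t (1 - s\<^sup>2) = (s - t) (1 + t s)\<close>, and \<open>1 + t s\<close> cancels against \<open>1 - (t s)\<^sup>2\<close>.\<close>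
    ultimately have "(s - t) * (1 + t * s) \<le> (cmod (hyperbolic_deriv \<omega> z) * (1 - t * s)) * (1 + t * s)"
      by (simp add: algebra_simps power2_eq_square)
    moreover have "0 < 1 + t * s" using t01 s01 by (simp add: add_pos_nonneg)
    ultimately show ?thesis by (rule mult_right_le_imp_le)
  qed
  show ?thesis by (rule that) fact+
qed

section \<open>Affine invariance of the harmonic Schwarzian\<close>

lemma dilatation_holomorphic:
  assumes "h holomorphic_on unit_disk" "g holomorphic_on unit_disk" "sense_preserving h g"
  shows "dilatation h g holomorphic_on unit_disk"
  unfolding dilatation_def[abs_def]
  by (intro holomorphic_intros holomorphic_deriv assms)
     (use assms(3) in \<open>auto simp: sense_preserving_def\<close>)

lemma pre_schwarzian_holomorphic:
  assumes "h holomorphic_on unit_disk" "\<And>z. z \<in> unit_disk \<Longrightarrow> deriv h z \<noteq> 0"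
  shows "pre_schwarzian h holomorphic_on unit_disk"
  unfolding pre_schwarzian_def[abs_def]
  by (intro holomorphic_intros holomorphic_deriv assms) auto

text \<open>
  The affine change \<open>f - cnj a \<cdot> cnj f\<close> of \<open>f = h + cnj g\<close> has the analytic parts \<open>h - cnj a \<cdot> g\<close> and
  \<open>g - a \<cdot> h\<close>. On dilatations it acts as a Moebius map, so any value can be moved to \<open>0\<close>.
\<close>

lemma dilatation_Moebius:
  assumes h: "h holomorphic_on unit_disk" and g: "g holomorphic_on unit_disk"
    and sp: "sense_preserving h g" and a: "cmod a < 1" and z: "z \<in> unit_disk"
  shows "deriv (\<lambda>z. h z - cnj a * g z) z = deriv h z * (1 - cnj a * dilatation h g z)"
    and "dilatation (\<lambda>z. h z - cnj a * g z) (\<lambda>z. g z - a * h z) z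
           = Moebius_function 0 a (dilatation h g z)"
proof -
  have nz: "deriv h z \<noteq> 0" using sp z by (auto simp: sense_preserving_def)
  have d: "(h has_field_derivative deriv h z) (at z)" "(g has_field_derivative deriv g z) (at z)"
    using holomorphic_derivI h g z open_ball by blast+
  have "((\<lambda>z. h z - cnj a * g z) has_field_derivative deriv h z - cnj a * deriv g z) (at z)"
    by (rule derivative_eq_intros d refl | simp)+
  thus d1: "deriv (\<lambda>z. h z - cnj a * g z) z = deriv h z * (1 - cnj a * dilatation h g z)"
    using nz by (simp add: DERIV_imp_deriv dilatation_def field_simps)
  have "((\<lambda>z. g z - a * h z) has_field_derivative deriv g z - a * deriv h z) (at z)"
    by (rule derivative_eq_intros d refl | simp)+
  hence d2: "deriv (\<lambda>z. g z - a * h z) z = deriv h z * (dilatation h g z - a)"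
    using nz by (simp add: DERIV_imp_deriv dilatation_def field_simps)
  show "dilatation (\<lambda>z. h z - cnj a * g z) (\<lambda>z. g z - a * h z) z
           = Moebius_function 0 a (dilatation h g z)"
    using nz by (simp add: dilatation_def[of "\<lambda>z. h z - cnj a * g z"] d1 d2 Moebius_function_simple)
qed

lemma sense_preserving_affine:
  assumes h: "h holomorphic_on unit_disk" and g: "g holomorphic_on unit_disk"
    and sp: "sense_preserving h g" and a: "cmod a < 1"
  shows "sense_preserving (\<lambda>z. h z - cnj a * g z) (\<lambda>z. g z - a * h z)"
  unfolding sense_preserving_def
proof
  fix z :: complex assume z: "z \<in> unit_disk"
  have w: "cmod (dilatation h g z) < 1" "deriv h z \<noteq> 0"
    using sp z by (auto simp: sense_preserving_def)
  show "deriv (\<lambda>z. h z - cnj a * g z) z \<noteq> 0 \<and>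
      cmod (dilatation (\<lambda>z. h z - cnj a * g z) (\<lambda>z. g z - a * h z) z) < 1"
    unfolding dilatation_Moebius[OF h g sp a z]
    using w a Moebius_function_norm_lt_1 one_minus_cnj_mult_nonzero[of a "dilatation h g z"] by auto
qed

text \<open>
  The conceptual reason is that \<open>S\<^sub>f = Q\<^sub>z - Q\<^sup>2/2\<close> where \<open>Q\<close> is the \<open>z\<close>-derivative of the logarithm of
  the Jacobian, and an affine map multiplies the Jacobian by a constant. In terms of
  \<open>q = cnj \<omega> / (1 - \<bar>\<omega>\<bar>\<^sup>2)\<close>, \<open>p = h''/h'\<close> and \<open>m = cnj a / (1 - cnj a \<cdot> \<omega>)\<close>, the invariance of
  \<open>Q = p - q \<omega>'\<close> reads: \<open>p\<close> decreases by \<open>m \<omega>'\<close>, and so does \<open>q \<omega>'\<close>. The proof computes how each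
  ingredient of the Schwarzian changes and compares.
\<close>

lemma harmonic_schwarzian_affine:
  assumes h: "h holomorphic_on unit_disk" and g: "g holomorphic_on unit_disk"
    and sp: "sense_preserving h g" and a: "cmod a < 1" and z: "z \<in> unit_disk"
  shows "harmonic_schwarzian (\<lambda>z. h z - cnj a * g z) (\<lambda>z. g z - a * h z) z = harmonic_schwarzian h g z"
proof -
  define h1 where "h1 = (\<lambda>z. h z - cnj a * g z)"
  define g1 where "g1 = (\<lambda>z. g z - a * h z)"
  define w where "w = dilatation h g"
  define p where "p = pre_schwarzian h"
  define c where "c = complex_of_real (1 - (cmod a)\<^sup>2)"
  have c: "c = 1 - a * cnj a"
    using complex_norm_square[of a] by (simp add: c_def)
  have c0: "c \<noteq> 0"
    using a unfolding c_def of_real_eq_0_iff by (simp add: abs_square_less_1 less_imp_neq[THEN not_sym])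
  have w1: "cmod (w u) < 1" "deriv h u \<noteq> 0" if "u \<in> unit_disk" for u
    using sp that by (auto simp: sense_preserving_def w_def)
  have nz: "1 - cnj a * w u \<noteq> 0" if "u \<in> unit_disk" for u
    using one_minus_cnj_mult_nonzero[OF a, of "w u"] w1[OF that] by simp
  have holw: "w holomorphic_on unit_disk" unfolding w_def by (rule dilatation_holomorphic[OF h g sp])
  have holp: "p holomorphic_on unit_disk" unfolding p_def by (rule pre_schwarzian_holomorphic[OF h w1(2)])
  have dh: "(deriv h has_field_derivative deriv (deriv h) u) (at u)"
    and dw: "(w has_field_derivative deriv w u) (at u)"
    and ddw: "(deriv w has_field_derivative deriv (deriv w) u) (at u)"
    and dp: "(p has_field_derivative deriv p u) (at u)" if "u \<in> unit_disk" for u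
    using that h holw holp by (meson holomorphic_derivI holomorphic_deriv open_ball)+
  have ddh1: "deriv (deriv h1) u = deriv (deriv h) u * (1 - cnj a * w u) - deriv h u * (cnj a * deriv w u)"
    if u: "u \<in> unit_disk" for u
  proof (rule deriv_eq_on_disk[OF _ _ u])
    show "((\<lambda>u. deriv h u * (1 - cnj a * w u)) has_field_derivative
        deriv (deriv h) u * (1 - cnj a * w u) - deriv h u * (cnj a * deriv w u)) (at u)"
      by (rule derivative_eq_intros dh[OF u] dw[OF u] refl | simp)+
  qed (simp add: h1_def w_def dilatation_Moebius(1)[OF h g sp a])
  have p1: "pre_schwarzian h1 u = p u - cnj a * deriv w u / (1 - cnj a * w u)" if u: "u \<in> unit_disk" for u
    unfolding pre_schwarzian_def ddh1[OF u] p_def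
    using nz[OF u] w1(2)[OF u]
    by (simp add: h1_def w_def[symmetric] dilatation_Moebius(1)[OF h g sp a u] divide_simps)
  have dp1: "deriv (pre_schwarzian h1) z = deriv p z - (cnj a * deriv (deriv w) z / (1 - cnj a * w z)
      + (cnj a * deriv w z / (1 - cnj a * w z))\<^sup>2)"
  proof (rule deriv_eq_on_disk[OF p1 _ z])
    show "((\<lambda>u. p u - cnj a * deriv w u / (1 - cnj a * w u)) has_field_derivative
       deriv p z - (cnj a * deriv (deriv w) z / (1 - cnj a * w z)
      + (cnj a * deriv w z / (1 - cnj a * w z))\<^sup>2)) (at z)"
      by (rule derivative_eq_intros dp[OF z] dw[OF z] ddw[OF z] refl nz[OF z] | simp)+
         (use nz[OF z] in \<open>simp add: divide_simps power2_eq_square\<close>)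
  qed
  define w' where "w' = dilatation h1 g1"
  have w'_eq: "w' u = (w u - a) / (1 - cnj a * w u)" if u: "u \<in> unit_disk" for u
    unfolding w'_def h1_def g1_def dilatation_Moebius(2)[OF h g sp a u] w_def Moebius_function_simple ..
  have dw': "deriv w' u = c * deriv w u / (1 - cnj a * w u)\<^sup>2" if u: "u \<in> unit_disk" for u
  proof (rule deriv_eq_on_disk[OF w'_eq _ u])
    show "((\<lambda>u. (w u - a) / (1 - cnj a * w u)) has_field_derivative c * deriv w u / (1 - cnj a * w u)\<^sup>2) (at u)"
      by (rule derivative_eq_intros dw[OF u] refl nz[OF u] | simp)+
         (use nz[OF u] in \<open>simp add: divide_simps power2_eq_square c algebra_simps\<close>)
  qed auto
  have ddw': "deriv (deriv w') z = c * (deriv (deriv w) z / (1 - cnj a * w z)\<^sup>2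
      + 2 * cnj a * (deriv w z)\<^sup>2 / (1 - cnj a * w z) ^ 3)"
  proof (rule deriv_eq_on_disk[OF dw' _ z])
    define n where "n = 1 - cnj a * w z"
    have n0: "n \<noteq> 0" using nz[OF z] by (simp add: n_def)
    have N: "((\<lambda>u. (1 - cnj a * w u)\<^sup>2) has_field_derivative - 2 * cnj a * deriv w z * n) (at z)"
      unfolding n_def by (rule derivative_eq_intros dw[OF z] refl | simp)+
    have "((\<lambda>u. c * deriv w u / (1 - cnj a * w u)\<^sup>2) has_field_derivative
       (c * deriv (deriv w) z * n\<^sup>2 - c * deriv w z * (- 2 * cnj a * deriv w z * n)) / (n\<^sup>2 * n\<^sup>2)) (at z)"
      using DERIV_divide[OF DERIV_cmult[OF ddw[OF z], of c] N] nz[OF z] by (simp add: n_def)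
    also have "(c * deriv (deriv w) z * n\<^sup>2 - c * deriv w z * (- 2 * cnj a * deriv w z * n)) / (n\<^sup>2 * n\<^sup>2)
       = c * (deriv (deriv w) z / n\<^sup>2 + 2 * cnj a * (deriv w z)\<^sup>2 / n ^ 3)"
      using n0 by (simp add: field_simps power2_eq_square power3_eq_cube)
    finally show "((\<lambda>u. c * deriv w u / (1 - cnj a * w u)\<^sup>2) has_field_derivative
       c * (deriv (deriv w) z / (1 - cnj a * w z)\<^sup>2
      + 2 * cnj a * (deriv w z)\<^sup>2 / (1 - cnj a * w z) ^ 3)) (at z)"
      unfolding n_def .
  qed
  define d where "d = complex_of_real (1 - (cmod (w z))\<^sup>2)"
  define d' where "d' = complex_of_real (1 - (cmod (w' z))\<^sup>2)"
  define q where "q = cnj (w z) / d"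
  define q' where "q' = cnj (w' z) / d'"
  define m where "m = cnj a / (1 - cnj a * w z)"
  have d: "d = 1 - w z * cnj (w z)"
    using complex_norm_square[of "w z"] by (simp add: d_def)
  have d0: "d \<noteq> 0"
    using w1(1)[OF z] unfolding d_def of_real_eq_0_iff by (simp add: abs_square_less_1 less_imp_neq[THEN not_sym])
  have nzc: "1 - a * cnj (w z) \<noteq> 0"
  proof
    assume "1 - a * cnj (w z) = 0"
    hence "cnj (1 - a * cnj (w z)) = 0" by simp
    thus False using nz[OF z] by simp
  qed
  have cw': "cnj (w' z) = (cnj (w z) - cnj a) / (1 - a * cnj (w z))"
    by (simp add: w'_eq[OF z])
  have d': "d' = c * d / ((1 - cnj a * w z) * (1 - a * cnj (w z)))"
  proof -
    have "d' = 1 - w' z * cnj (w' z)"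
      using complex_norm_square[of "w' z"] by (simp add: d'_def)
    also have "\<dots> = c * d / ((1 - cnj a * w z) * (1 - a * cnj (w z)))"
      unfolding cw' w'_eq[OF z] c d using nz[OF z] nzc by (simp add: divide_simps, simp add: algebra_simps)
    finally show ?thesis .
  qed
  \<comment> \<open>This is the transformation law of \<open>q\<close>; it makes \<open>q \<omega>'\<close> decrease by exactly \<open>m \<omega>'\<close>.\<close>
  have qm: "q' * c / (1 - cnj a * w z)\<^sup>2 = q - m"
  proof -
    have "q' * c / (1 - cnj a * w z)\<^sup>2 = (cnj (w z) - cnj a) / ((1 - cnj a * w z) * d)"
      unfolding q'_def cw' d' using nz[OF z] nzc c0 d0 by (simp add: divide_simps power2_eq_square)
    also have "\<dots> = q - m"
      unfolding q_def m_def using nz[OF z] d0 by (simp add: divide_simps) (simp add: d algebra_simps)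
    finally show ?thesis .
  qed
  have e1: "q' * deriv w' z = (q - m) * deriv w z"
    unfolding dw'[OF z] qm[symmetric] by simp
  have "c * (deriv (deriv w) z / (1 - cnj a * w z)\<^sup>2
      + 2 * cnj a * (deriv w z)\<^sup>2 / (1 - cnj a * w z) ^ 3)
      = c / (1 - cnj a * w z)\<^sup>2 * (deriv (deriv w) z + 2 * m * (deriv w z)\<^sup>2)"
    unfolding m_def using nz[OF z] by (simp add: divide_simps power2_eq_square power3_eq_cube)
  hence e2: "q' * deriv (deriv w') z = (q - m) * (deriv (deriv w) z + 2 * m * (deriv w z)\<^sup>2)"
    unfolding ddw' qm[symmetric] by simp
  have e3: "pre_schwarzian h1 z = p z - m * deriv w z"
    unfolding p1[OF z] m_def by simp
  have e4: "deriv (pre_schwarzian h1) z = deriv p z - (m * deriv (deriv w) z + (m * deriv w z)\<^sup>2)"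
    unfolding dp1 m_def by simp
  have "harmonic_schwarzian h1 g1 z = deriv (pre_schwarzian h1) z - 1 / 2 * (pre_schwarzian h1 z)\<^sup>2
      + (pre_schwarzian h1 z * (q' * deriv w' z) - q' * deriv (deriv w') z) - 3 / 2 * (q' * deriv w' z)\<^sup>2"
    unfolding harmonic_schwarzian_def Let_def schwarzian_def w'_def[symmetric] d'_def[symmetric] q'_def
    by (simp add: algebra_simps)
  also have "\<dots> = deriv p z - 1 / 2 * (p z)\<^sup>2
      + (p z * (q * deriv w z) - q * deriv (deriv w) z) - 3 / 2 * (q * deriv w z)\<^sup>2"
    unfolding e1 e2 e3 e4 by (simp add: field_simps power2_eq_square)
  also have "\<dots> = harmonic_schwarzian h g z"
    unfolding harmonic_schwarzian_def Let_def schwarzian_def w_def[symmetric] d_def[symmetric] p_def[symmetric] q_def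
    by (simp add: algebra_simps)
  finally show ?thesis unfolding h1_def g1_def .
qed

section \<open>The lower bound for the Schwarzian norm\<close>

text \<open>
  Closedness is meant in the plane: a pseudo-hyperbolic disk of radius less than \<open>1\<close> stays away from
  the unit circle.
\<close>

lemma closed_pseudo_hyperbolic_disk:
  assumes z0: "cmod z0 < 1" and r: "0 \<le> r" "r < 1"
  shows "closed {z \<in> unit_disk. cmod (Moebius_function 0 z0 z) \<le> r}"
proof -
  have "{z \<in> unit_disk. cmod (Moebius_function 0 z0 z) \<le> r}
      = cball 0 1 \<inter> {z. cmod (z - z0) \<le> r * cmod (1 - cnj z0 * z)}" (is "?A = ?K")
  proof (intro equalityI subsetI)
    fix z assume "z \<in> ?A"
    hence z: "cmod z < 1" "cmod (Moebius_function 0 z0 z) \<le> r" by auto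
    moreover have "cmod (1 - cnj z0 * z) > 0"
      using one_minus_cnj_mult_nonzero[of z0 z] z z0 by simp
    ultimately show "z \<in> ?K" by (simp add: Moebius_function_simple norm_divide divide_le_eq)
  next
    fix z assume "z \<in> ?K"
    hence z: "cmod z \<le> 1" "cmod (z - z0) \<le> r * cmod (1 - cnj z0 * z)" by auto
    have pos: "cmod (1 - cnj z0 * z) > 0"
      using one_minus_cnj_mult_nonzero[of z0 z] z z0 by simp
    have "r * cmod (1 - cnj z0 * z) < 1 * cmod (1 - cnj z0 * z)"
      by (rule mult_strict_right_mono) (use r pos in auto)
    hence "cmod (z - z0) < cmod (1 - cnj z0 * z)" using z by simp
    hence "(cmod (1 - cnj z0 * z))\<^sup>2 \<noteq> (cmod (z - z0))\<^sup>2" by simp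
    hence "cmod z \<noteq> 1" using norm_pseudo_hyperbolic_identity[of z0 z] by auto
    thus "z \<in> ?A" using z pos by (simp add: Moebius_function_simple norm_divide divide_le_eq)
  qed
  also have "closed \<dots>"
    by (intro closed_Int closed_cball closed_Collect_le continuous_intros)
  finally show ?thesis .
qed

text \<open>
  The maximum principle for the function \<open>G\<close> that agrees with \<open>(\<omega>/\<omega>')\<^sup>2 S\<^sub>f\<close> on the level curve
  \<open>\<bar>\<omega>\<bar> = \<rho>\<close>. The hypothesis on the boundary of the pseudo-hyperbolic disk confines the component of
  \<open>{\<bar>\<omega>\<bar> < \<rho>}\<close> containing \<open>z0\<close> to that disk, so that \<open>\<bar>\<omega>\<bar> = \<rho>\<close> on the entire frontier of the domain
  used; the hypothesis \<open>\<kappa> \<le> \<bar>\<omega>\<^sup>*\<bar>\<close> makes \<open>G\<close> holomorphic there and controls the factor \<open>1/\<omega>'\<close>.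
\<close>

lemma schwarzian_bound_level_curve:
  assumes h: "h holomorphic_on unit_disk" and g: "g holomorphic_on unit_disk" and sp: "sense_preserving h g"
    and bound: "\<And>z. z \<in> unit_disk \<Longrightarrow> cmod (harmonic_schwarzian h g z) * (1 - (cmod z)\<^sup>2)\<^sup>2 \<le> L"
    and z0: "z0 \<in> unit_disk" and zero: "dilatation h g z0 = 0"
    and \<rho>: "0 < \<rho>" "\<rho> < 1" and \<kappa>: "0 < \<kappa>" and r: "0 < r" "r < 1"
    and near: "\<And>z. z \<in> unit_disk \<Longrightarrow> cmod (Moebius_function 0 z0 z) \<le> r \<Longrightarrow>
                 \<kappa> \<le> cmod (hyperbolic_deriv (dilatation h g) z)"
    and bdry: "\<And>z. z \<in> unit_disk \<Longrightarrow> cmod (Moebius_function 0 z0 z) = r \<Longrightarrow> \<rho> < cmod (dilatation h g z)"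
  shows "3 / 2 * (\<rho> * \<kappa>)\<^sup>2 \<le> L"
proof -
  define w where "w = dilatation h g"
  define p where "p = pre_schwarzian h"
  define k where "k = \<rho>\<^sup>2 / (1 - \<rho>\<^sup>2)"
  define G where "G = (\<lambda>z. (w z / deriv w z)\<^sup>2 * (deriv p z - 1 / 2 * (p z)\<^sup>2)
     + of_real k * (w z / (deriv w z)\<^sup>2) * (p z * deriv w z - deriv (deriv w) z) - 3 / 2 * (of_real k)\<^sup>2)"
  have z01: "cmod z0 < 1" using z0 by simp
  have pos\<rho>: "0 < 1 - \<rho>\<^sup>2" using \<rho> by (simp add: abs_square_less_1)
  have L0: "0 \<le> L"
    using bound[OF z0] by (meson order_trans mult_nonneg_nonneg norm_ge_zero zero_le_power2)
  have w1: "cmod (w u) < 1" "deriv h u \<noteq> 0" if "u \<in> unit_disk" for u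
    using sp that by (auto simp: sense_preserving_def w_def)
  have holw: "w holomorphic_on unit_disk" unfolding w_def by (rule dilatation_holomorphic[OF h g sp])
  have holp: "p holomorphic_on unit_disk" unfolding p_def by (rule pre_schwarzian_holomorphic[OF h w1(2)])
  let ?M = "Moebius_function 0 z0"
  define K where "K = {z \<in> unit_disk. cmod (?M z) \<le> r}"
  define U where "U = {z \<in> unit_disk. cmod (?M z) < r \<and> cmod (w z) < \<rho>}"
  define C where "C = {z \<in> K. cmod (w z) \<le> \<rho>}"
  have KD: "K \<subseteq> unit_disk" by (auto simp: K_def)
  have contM: "continuous_on unit_disk (\<lambda>z. cmod (?M z))"
    and contw: "continuous_on unit_disk (\<lambda>z. cmod (w z))"
    using Moebius_function_holomorphic[OF z01] holw
    by (auto intro!: continuous_on_norm holomorphic_on_imp_continuous_on)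
  have openU: "open U"
  proof -
    have "U = (unit_disk \<inter> (\<lambda>z. cmod (?M z)) -` {..<r}) \<inter> (unit_disk \<inter> (\<lambda>z. cmod (w z)) -` {..<\<rho>})"
      by (auto simp: U_def)
    thus ?thesis
      by (simp only:) (intro open_Int continuous_open_preimage contM contw open_ball open_lessThan)
  qed
  have "closed K"
    unfolding K_def using closed_pseudo_hyperbolic_disk[OF z01, of r] r by simp
  moreover have "C = K \<inter> (\<lambda>z. cmod (w z)) -` {..\<rho>}" by (auto simp: C_def)
  ultimately have "closed C"
    by (simp only:) (intro continuous_closed_preimage continuous_on_subset[OF contw KD] closed_atMost)
  hence clU: "closure U \<subseteq> C"
    by (intro closure_minimal) (auto simp: U_def C_def K_def)
  have w'nz: "deriv w z \<noteq> 0" if "z \<in> K" for z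
    using near[of z] \<kappa> that by (auto simp: K_def w_def hyperbolic_deriv_def)
  have UK: "U \<subseteq> K" by (auto simp: U_def K_def)
  have CK: "C \<subseteq> K" by (auto simp: C_def)
  have UD: "U \<subseteq> unit_disk" using UK KD by blast
  define V where "V = {z \<in> unit_disk. deriv w z \<noteq> 0}"
  have VD: "V \<subseteq> unit_disk" by (auto simp: V_def)
  have holV: "w holomorphic_on V" "deriv w holomorphic_on V" "deriv (deriv w) holomorphic_on V"
      "p holomorphic_on V" "deriv p holomorphic_on V"
    using holomorphic_on_subset[OF _ VD] holw holp holomorphic_deriv[OF _ open_ball] by blast+
  have holG: "G holomorphic_on V"
    unfolding G_def by (intro holomorphic_intros holV) (auto simp: V_def)
  have KV: "K \<subseteq> V" using KD w'nz by (auto simp: V_def)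
  define B where "B = \<rho>\<^sup>2 * L / (\<kappa> * (1 - \<rho>\<^sup>2))\<^sup>2"
  have "cmod (G z0) \<le> B"
  proof (rule maximum_modulus_frontier[where S = U and f = G])
    show "G holomorphic_on interior U"
      using UK KV by (intro holomorphic_on_subset[OF holG]) (auto simp: interior_open[OF openU])
    show "continuous_on (closure U) G"
      using clU CK KV by (intro holomorphic_on_imp_continuous_on holomorphic_on_subset[OF holG]) auto
    show "bounded U" using UD bounded_ball bounded_subset by blast
    show "z0 \<in> U" using z0 zero r \<rho> by (simp add: U_def w_def Moebius_function_eq_zero)
    fix z assume "z \<in> frontier U"
    hence zC: "z \<in> C" and zU: "z \<notin> U"
      using clU by (auto simp: frontier_def interior_open[OF openU])
    hence z: "z \<in> unit_disk" "cmod (?M z) \<le> r" "cmod (w z) \<le> \<rho>" and zK: "z \<in> K"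
      by (auto simp: C_def K_def)
    \<comment> \<open>A frontier point with \<open>\<bar>\<omega>\<bar> < \<rho>\<close> would lie on the rim of the pseudo-hyperbolic disk, where \<open>\<bar>\<omega>\<bar> > \<rho>\<close>.\<close>
    hence wz: "cmod (w z) = \<rho>"
      using zU bdry[OF z(1)] by (force simp: U_def w_def)
    have pz: "0 < 1 - (cmod z)\<^sup>2" using z by (simp add: abs_square_less_1)
    have w'0: "deriv w z \<noteq> 0" by (rule w'nz[OF zK])
    define q where "q = cnj (w z) / of_real (1 - (cmod (w z))\<^sup>2)"
    \<comment> \<open>The only non-holomorphic factor of the Schwarzian is constant on the level curve after multiplication by \<open>\<omega>\<close>.\<close>
    have wq: "of_real k = w z * q"
      using complex_norm_square[of "w z"] by (simp add: q_def k_def wz)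
    have "G z = (w z / deriv w z)\<^sup>2 * harmonic_schwarzian h g z"
      unfolding harmonic_schwarzian_def Let_def schwarzian_def w_def[symmetric] p_def[symmetric] q_def[symmetric]
        G_def wq times_divide_eq_right[symmetric]
      using w'0 by (simp add: field_simps power2_eq_square)
    hence "cmod (G z) = (\<rho> / cmod (deriv w z))\<^sup>2 * cmod (harmonic_schwarzian h g z)"
      by (simp add: norm_mult norm_divide norm_power wz)
    also have "\<dots> = \<rho>\<^sup>2 * (cmod (harmonic_schwarzian h g z) * (1 - (cmod z)\<^sup>2)\<^sup>2)
        / (cmod (deriv w z) * (1 - (cmod z)\<^sup>2))\<^sup>2"
      using pz w'0 by (simp add: power_mult_distrib power_divide)
    also have "\<dots> \<le> \<rho>\<^sup>2 * L / (\<kappa> * (1 - \<rho>\<^sup>2))\<^sup>2"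
    proof (rule frac_le)
      show "\<rho>\<^sup>2 * (cmod (harmonic_schwarzian h g z) * (1 - (cmod z)\<^sup>2)\<^sup>2) \<le> \<rho>\<^sup>2 * L"
        by (rule mult_left_mono[OF bound[OF z(1)]]) simp
      show "0 < (\<kappa> * (1 - \<rho>\<^sup>2))\<^sup>2" using \<kappa> pos\<rho> by simp
      have "\<kappa> \<le> cmod (deriv w z) * (1 - (cmod z)\<^sup>2) / (1 - \<rho>\<^sup>2)"
        using near[OF z(1,2)] cmod_hyperbolic_deriv[of z w] z(1) wz \<rho> by (simp add: w_def)
      hence "\<kappa> * (1 - \<rho>\<^sup>2) \<le> cmod (deriv w z) * (1 - (cmod z)\<^sup>2)"
        using pos\<rho> by (simp add: le_divide_eq)
      thus "(\<kappa> * (1 - \<rho>\<^sup>2))\<^sup>2 \<le> (cmod (deriv w z) * (1 - (cmod z)\<^sup>2))\<^sup>2"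
        using \<kappa> pos\<rho> by (intro power_mono) auto
    qed (use L0 in simp)
    finally show "cmod (G z) \<le> B" unfolding B_def .
  qed
  moreover have "cmod (G z0) = 3 / 2 * k\<^sup>2"
    using zero by (simp add: G_def w_def norm_mult norm_power)
  ultimately have "3 / 2 * k\<^sup>2 \<le> B" by simp
  hence "3 / 2 * (\<rho>\<^sup>2 / (1 - \<rho>\<^sup>2))\<^sup>2 * ((\<kappa> * (1 - \<rho>\<^sup>2))\<^sup>2 / \<rho>\<^sup>2) \<le> B * ((\<kappa> * (1 - \<rho>\<^sup>2))\<^sup>2 / \<rho>\<^sup>2)"
    unfolding k_def by (rule mult_right_mono) auto
  moreover have "3 / 2 * (\<rho>\<^sup>2 / (1 - \<rho>\<^sup>2))\<^sup>2 * ((\<kappa> * (1 - \<rho>\<^sup>2))\<^sup>2 / \<rho>\<^sup>2) = 3 / 2 * (\<rho> * \<kappa>)\<^sup>2"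
    using pos\<rho> \<rho> by (simp add: power_mult_distrib power_divide)
      (simp add: power2_eq_square power4_eq_xxxx)
  moreover have "B * ((\<kappa> * (1 - \<rho>\<^sup>2))\<^sup>2 / \<rho>\<^sup>2) = L"
    using pos\<rho> \<rho> \<kappa> by (simp add: B_def)
  ultimately show ?thesis by (simp only:)
qed

text \<open>
  For \<open>x < 1\<close> take \<open>\<rho> = \<kappa> = x\<close> in \<open>schwarzian_bound_level_curve\<close> and a pseudo-hyperbolic radius \<open>r\<close>
  between \<open>x\<close> and \<open>1\<close>. The two lower bounds of \<open>hyperbolic_deriv_near_zero\<close> are both of the form
  \<open>m s = (s - r) / (1 - r s)\<close>, so \<open>\<bar>\<omega>\<^sup>*\<bar> \<ge> m (m s0)\<close> on the disk; since \<open>m\<close> is continuous with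
  \<open>m 1 = 1\<close>, this exceeds \<open>x\<close> once \<open>s0 = \<bar>\<omega>\<^sup>*(z0)\<bar>\<close> is close enough to \<open>1\<close>. On the rim
  \<open>\<bar>\<omega>\<bar> = r s \<ge> r \<cdot> m s0\<close>, which is why \<open>m s0 > x / r\<close> is arranged as well.
\<close>

lemma three_halves_le_schwarzian_bound:
  assumes h: "h holomorphic_on unit_disk" and g: "g holomorphic_on unit_disk" and sp: "sense_preserving h g"
    and bound: "\<And>z. z \<in> unit_disk \<Longrightarrow> cmod (harmonic_schwarzian h g z) * (1 - (cmod z)\<^sup>2)\<^sup>2 \<le> L"
    and large: "\<And>x. x < 1 \<Longrightarrow> \<exists>z\<in>unit_disk. x < cmod (hyperbolic_deriv (dilatation h g) z)"
  shows "3 / 2 \<le> L"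
proof -
  have key: "3 / 2 * (x * x)\<^sup>2 \<le> L" if x: "0 < x" "x < 1" for x
  proof -
    define r where "r = (1 + x) / 2"
    have r: "0 < r" "r < 1" "x < r" using x by (auto simp: r_def)
    define m where "m = (\<lambda>s. (s - r) / (1 - r * s))"
    have m1: "m 1 = 1" using r by (simp add: m_def)
    have cont: "isCont m 1" unfolding m_def using r by (intro continuous_intros) auto
    have "isCont m (m 1)" using cont m1 by simp
    hence "isCont (\<lambda>s. m (m s)) 1" by (rule isCont_o2[OF cont])
    hence lim: "(m \<longlongrightarrow> 1) (nhds 1)" "((\<lambda>s. m (m s)) \<longlongrightarrow> 1) (nhds 1)"
      using cont tendsto_at_iff_tendsto_nhds[where g = m and l = 1]
        tendsto_at_iff_tendsto_nhds[where g = "\<lambda>s. m (m s)" and l = 1]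
      by (auto simp: isCont_def m1)
    have "x / r < 1" using r by simp
    hence "\<forall>\<^sub>F s in nhds 1. x / r < m s \<and> x < m (m s)"
      using lim x by (intro eventually_conj order_tendstoD(1)[OF lim(1)] order_tendstoD(1)[OF lim(2)])
    then obtain d where d: "d > 0" "\<And>s. dist s 1 < d \<Longrightarrow> x / r < m s \<and> x < m (m s)"
      unfolding eventually_nhds_metric by blast
    obtain z0 where z0: "z0 \<in> unit_disk" "1 - d < cmod (hyperbolic_deriv (dilatation h g) z0)"
      using large[of "1 - d"] d(1) by auto
    define \<omega> where "\<omega> = dilatation h g"
    define a where "a = \<omega> z0"
    define h1 where "h1 = (\<lambda>z. h z - cnj a * g z)"
    define g1 where "g1 = (\<lambda>z. g z - a * h z)"
    define \<omega>1 where "\<omega>1 = dilatation h1 g1"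
    have hol: "\<omega> holomorphic_on unit_disk"
      unfolding \<omega>_def by (rule dilatation_holomorphic[OF h g sp])
    have lt: "cmod (\<omega> z) < 1" if "z \<in> unit_disk" for z
      using sp that by (auto simp: sense_preserving_def \<omega>_def)
    have a: "cmod a < 1" unfolding a_def by (rule lt[OF z0(1)])
    have h1: "h1 holomorphic_on unit_disk" and g1: "g1 holomorphic_on unit_disk"
      unfolding h1_def g1_def by (intro holomorphic_intros h g)+
    have sp1: "sense_preserving h1 g1"
      unfolding h1_def g1_def by (rule sense_preserving_affine[OF h g sp a])
    have \<omega>1_eq: "\<omega>1 z = Moebius_function 0 a (\<omega> z)" if "z \<in> unit_disk" for z
      unfolding \<omega>1_def h1_def g1_def \<omega>_def by (rule dilatation_Moebius(2)[OF h g sp a that])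
    have hol1: "\<omega>1 holomorphic_on unit_disk"
      unfolding \<omega>1_def by (rule dilatation_holomorphic[OF h1 g1 sp1])
    have lt1: "cmod (\<omega>1 z) < 1" if "z \<in> unit_disk" for z
      using sp1 that by (auto simp: sense_preserving_def \<omega>1_def)
    have zero: "\<omega>1 z0 = 0" using \<omega>1_eq[OF z0(1)] by (simp add: a_def Moebius_function_eq_zero)
    define s0 where "s0 = cmod (hyperbolic_deriv \<omega>1 z0)"
    have "s0 = cmod (hyperbolic_deriv \<omega> z0)"
      unfolding s0_def by (rule hyperbolic_deriv_Moebius_compose[OF hol lt \<omega>1_eq a z0(1)])
    hence s0: "1 - d < s0" "s0 \<le> 1"
      using z0 hyperbolic_deriv_le_1[OF hol lt z0(1)] by (auto simp: \<omega>_def)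
    hence ms: "x / r < m s0" "x < m (m s0)"
      using d(2)[of s0] by (auto simp: dist_real_def)
    have "0 < x / r" using x r by simp
    hence ms0: "0 < m s0" using ms by linarith
    have rs0: "r * s0 < 1" using s0 r by (smt (verit) mult_left_le mult_less_cancel_left1)
    have est: "m s0 \<le> s \<and> m (m s0) \<le> cmod (hyperbolic_deriv \<omega>1 z)"
      if z: "z \<in> unit_disk" and t: "cmod (Moebius_function 0 z0 z) \<le> r" and s: "s \<le> 1"
        and e1: "s0 - cmod (Moebius_function 0 z0 z) \<le> s * (1 - cmod (Moebius_function 0 z0 z) * s0)"
        and e2: "s - cmod (Moebius_function 0 z0 z)
             \<le> cmod (hyperbolic_deriv \<omega>1 z) * (1 - cmod (Moebius_function 0 z0 z) * s)"
      for z s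
    proof -
      define t where "t = cmod (Moebius_function 0 z0 z)"
      define k where "k = cmod (hyperbolic_deriv \<omega>1 z)"
      have t0: "0 \<le> t" "t \<le> r" using t by (auto simp: t_def)
      have k1: "k \<le> 1" "0 \<le> k" unfolding k_def using hyperbolic_deriv_le_1[OF hol1 lt1 z] by auto
      have ss0: "s * s0 \<le> 1"
        using s s0 by (smt (verit) mult_left_le mult_nonneg_nonpos2 s0_def norm_ge_zero)
      \<comment> \<open>The bound \<open>(s0 - t) / (1 - t s0)\<close> decreases in \<open>t\<close>, so \<open>t\<close> may be replaced by \<open>r\<close>; likewise below.\<close>
      have "t * (1 - s * s0) \<le> r * (1 - s * s0)" using t0 ss0 by (intro mult_right_mono) auto
      hence "s0 - r \<le> s * (1 - r * s0)"
        using e1 unfolding t_def[symmetric] by (simp add: algebra_simps)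
      hence ms: "m s0 \<le> s" unfolding m_def using rs0 by (simp add: divide_le_eq)
      have s0': "0 < s" using ms ms0 by linarith
      have rs: "r * s < 1" using s r by (smt (verit) mult_left_le mult_less_cancel_left1)
      have rms: "r * m s0 < 1" using ms rs r by (smt (verit) mult_left_mono)
      have "k * s \<le> 1" using k1 s s0' by (simp add: mult_le_one)
      hence "t * (1 - k * s) \<le> r * (1 - k * s)" using t0 by (intro mult_right_mono) auto
      hence "s - r \<le> k * (1 - r * s)"
        using e2 unfolding t_def[symmetric] k_def[symmetric] by (simp add: algebra_simps)
      hence k: "(s - r) / (1 - r * s) \<le> k" using rs by (simp add: divide_le_eq)
      \<comment> \<open>\<open>m\<close> is increasing.\<close>
      have "0 \<le> (s - m s0) * (1 - r\<^sup>2)" using ms r by (intro mult_nonneg_nonneg) (auto simp: power_le_one)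
      hence "(m s0 - r) * (1 - r * s) \<le> (s - r) * (1 - r * m s0)"
        by (simp add: algebra_simps power2_eq_square)
      hence "m (m s0) \<le> (s - r) / (1 - r * s)"
        unfolding fun_cong[OF m_def, of "m s0"] using rs rms by (simp add: divide_simps mult.commute)
      thus ?thesis using ms k unfolding k_def by simp
    qed
    show ?thesis
    proof (rule schwarzian_bound_level_curve[where h = h1 and g = g1 and ?z0.0 = z0 and \<rho> = x and \<kappa> = x and r = r])
      show "cmod (harmonic_schwarzian h1 g1 z) * (1 - (cmod z)\<^sup>2)\<^sup>2 \<le> L" if "z \<in> unit_disk" for z
        using bound[OF that] harmonic_schwarzian_affine[OF h g sp a that] by (simp add: h1_def g1_def)
      show "dilatation h1 g1 z0 = 0" using zero by (simp add: \<omega>1_def)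
      fix z assume z: "z \<in> unit_disk"
      obtain s where s: "0 \<le> s" "s \<le> 1" "cmod (\<omega>1 z) = cmod (Moebius_function 0 z0 z) * s"
        "s0 - cmod (Moebius_function 0 z0 z) \<le> s * (1 - cmod (Moebius_function 0 z0 z) * s0)"
        "s - cmod (Moebius_function 0 z0 z) \<le> cmod (hyperbolic_deriv \<omega>1 z) * (1 - cmod (Moebius_function 0 z0 z) * s)"
        using hyperbolic_deriv_near_zero[OF hol1 lt1 z0(1) zero z] unfolding s0_def by blast
      show "x \<le> cmod (hyperbolic_deriv (dilatation h1 g1) z)" if "cmod (Moebius_function 0 z0 z) \<le> r"
        using est[OF z that s(2,4,5)] ms by (simp add: \<omega>1_def)
      show "x < cmod (dilatation h1 g1 z)" if t: "cmod (Moebius_function 0 z0 z) = r"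
      proof -
        have "m s0 \<le> s" using est[OF z _ s(2,4,5)] t by simp
        hence "x / r < s" using ms by linarith
        thus ?thesis using s(3) t r by (simp add: \<omega>1_def divide_less_eq mult.commute)
      qed
    qed (use h1 g1 sp1 z0(1) x r in auto)
  qed
  have "((\<lambda>x::real. 3 / 2 * (x * x)\<^sup>2) \<longlongrightarrow> 3 / 2 * (1 * 1)\<^sup>2) (at_left 1)"
    by (intro tendsto_intros)
  moreover have "\<forall>\<^sub>F x::real in at_left 1. 3 / 2 * (x * x)\<^sup>2 \<le> L"
    by (rule eventually_at_leftI[of 0]) (use key in auto)
  ultimately have "3 / 2 * (1 * 1)\<^sup>2 \<le> L"
    by (rule tendsto_upperbound) simp
  thus ?thesis by simp
qed

section \<open>Admissible dilatations\<close>

text \<open>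
  The difference of two decompositions is a function that is both holomorphic and antiholomorphic; its
  real-linear derivative commutes and anticommutes with \<open>\<i>\<close>, hence vanishes.
\<close>

lemma harmonic_decomposition_deriv_unique:
  assumes "harmonic_decomposition f h g" "harmonic_decomposition f h' g'" and z: "z \<in> unit_disk"
  shows "deriv h z = deriv h' z" "deriv g z = deriv g' z"
proof -
  have hol: "h holomorphic_on unit_disk" "g holomorphic_on unit_disk" "h' holomorphic_on unit_disk" "g' holomorphic_on unit_disk"
    and eq: "\<And>u. u \<in> unit_disk \<Longrightarrow> h u - h' u = cnj (g' u - g u)"
    using assms(1,2) by (auto simp: harmonic_decomposition_def algebra_simps)
  define H where "H = deriv h z - deriv h' z"
  define G where "G = deriv g' z - deriv g z"
  have d: "((\<lambda>u. h u - h' u) has_field_derivative H) (at z)" "((\<lambda>u. g' u - g u) has_field_derivative G) (at z)"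
    unfolding H_def G_def using hol z by (auto intro!: DERIV_diff intro: holomorphic_derivI[OF _ open_ball])
  have "((\<lambda>u. cnj (g' u - g u)) has_derivative (\<lambda>v. cnj (G * v))) (at z)"
    using d(2) unfolding has_field_derivative_def by (rule has_derivative_cnj)
  hence "((\<lambda>u. h u - h' u) has_derivative (\<lambda>v. cnj (G * v))) (at z)"
    by (rule has_derivative_transform_within_open[OF _ open_ball z]) (simp add: eq)
  moreover have "((\<lambda>u. h u - h' u) has_derivative (\<lambda>v. H * v)) (at z)"
    using d(1) unfolding has_field_derivative_def .
  ultimately have e: "(\<lambda>v. cnj (G * v)) = (\<lambda>v. H * v)"
    by (rule has_derivative_unique)
  have "cnj G = H" "- \<i> * cnj G = H * \<i>"
    using fun_cong[OF e, of 1] fun_cong[OF e, of \<i>] by auto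
  hence "H = 0" "G = 0" by (auto simp: complex_eq_iff)
  thus "deriv h z = deriv h' z" "deriv g z = deriv g' z" by (auto simp: H_def G_def)
qed

text \<open>
  Membership in the family and the dilatation may be witnessed by different decompositions of the same
  harmonic mapping; uniqueness of the derivatives lets one pair serve for both.
\<close>

lemma admissible_dilatationE:
  assumes "\<omega> \<in> admissible_dilatations L"
  obtains h g where "h holomorphic_on unit_disk" "g holomorphic_on unit_disk" "sense_preserving h g"
    "\<And>z. z \<in> unit_disk \<Longrightarrow> cmod (harmonic_schwarzian h g z) * (1 - (cmod z)\<^sup>2)\<^sup>2 \<le> L"
    "\<And>z. z \<in> unit_disk \<Longrightarrow> \<omega> z = dilatation h g z"
proof -
  obtain f h' g' h g where f: "harmonic_decomposition f h g" "sense_preserving h g" "schwarzian_norm h g \<le> ereal L"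
      "harmonic_decomposition f h' g'" "\<And>z. z \<in> unit_disk \<Longrightarrow> \<omega> z = dilatation h' g' z"
    using assms unfolding admissible_dilatations_def dilatations_def harmonic_family_def by blast
  show ?thesis
  proof (rule that)
    show "cmod (harmonic_schwarzian h g z) * (1 - (cmod z)\<^sup>2)\<^sup>2 \<le> L" if "z \<in> unit_disk" for z
      using f(3) that by (auto simp: schwarzian_norm_def SUP_le_iff)
    show "\<omega> z = dilatation h g z" if "z \<in> unit_disk" for z
      using f(5)[OF that] harmonic_decomposition_deriv_unique[OF f(1,4) that] by (simp add: dilatation_def)
  qed (use f in \<open>auto simp: harmonic_decomposition_def\<close>)
qed

lemma admissible_dilatations0_subset: "admissible_dilatations0 L \<subseteq> admissible_dilatations L"
  by (auto simp: admissible_dilatations0_def admissible_dilatations_def dilatations_def harmonic_family0_def)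

lemma admissible_dilatation0_zero:
  assumes "\<omega> \<in> admissible_dilatations0 L"
  shows "\<omega> 0 = 0"
proof -
  obtain f h g h' g' where f: "harmonic_decomposition f h g" "deriv g 0 = 0"
     "harmonic_decomposition f h' g'" "\<And>z. z \<in> unit_disk \<Longrightarrow> \<omega> z = dilatation h' g' z"
    using assms unfolding admissible_dilatations0_def dilatations_def harmonic_family0_def by blast
  have "deriv g' 0 = 0"
    using harmonic_decomposition_deriv_unique(2)[OF f(1,3), of 0] f(2) by simp
  thus ?thesis using f(4)[of 0] by (simp add: dilatation_def)
qed

lemma three_halves_le_if_hyperbolic_deriv_near_1:
  assumes "\<omega> \<in> admissible_dilatations L"
    and large: "\<And>x. x < 1 \<Longrightarrow> \<exists>z\<in>unit_disk. x < cmod (hyperbolic_deriv \<omega> z)"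
  shows "3 / 2 \<le> L"
proof -
  obtain h g where hg: "h holomorphic_on unit_disk" "g holomorphic_on unit_disk" "sense_preserving h g"
    "\<And>z. z \<in> unit_disk \<Longrightarrow> cmod (harmonic_schwarzian h g z) * (1 - (cmod z)\<^sup>2)\<^sup>2 \<le> L"
    and eq: "\<And>z. z \<in> unit_disk \<Longrightarrow> \<omega> z = dilatation h g z"
    using admissible_dilatationE[OF assms(1)] by blast
  have "hyperbolic_deriv \<omega> z = hyperbolic_deriv (dilatation h g) z" if z: "z \<in> unit_disk" for z
  proof -
    have "deriv \<omega> z = deriv (dilatation h g) z"
      by (rule deriv_eq_on_disk[OF eq _ z])
         (use z dilatation_holomorphic[OF hg(1-3)] in \<open>auto intro: holomorphic_derivI[OF _ open_ball]\<close>)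
    thus ?thesis by (simp add: hyperbolic_deriv_def eq[OF z])
  qed
  thus ?thesis
    using large by (intro three_halves_le_schwarzian_bound[OF hg]) auto
qed

section \<open>Automorphisms as dilatations\<close>

text \<open>
  The extremal mappings \<open>h = (\<sigma> - \<sigma>(0)) / c\<close>, \<open>g = (\<sigma>\<^sup>2 - \<sigma>(0)\<^sup>2) / (2 c)\<close> with \<open>c = \<sigma>'(0)\<close>. They satisfy
  \<open>\<bar>S\<^sub>f\<bar> (1 - \<bar>z\<bar>\<^sup>2)\<^sup>2 = 3/2 \<cdot> \<bar>\<sigma>\<bar>\<^sup>2\<close>.
\<close>

lemma Moebius_admissible:
  assumes \<mu>: "cmod \<mu> = 1" and a: "cmod a < 1" and L: "3 / 2 \<le> L"
    and \<sigma>: "\<And>z. z \<in> unit_disk \<Longrightarrow> \<sigma> z = \<mu> * Moebius_function 0 a z"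
  shows "\<sigma> \<in> admissible_dilatations L" and "a = 0 \<Longrightarrow> \<sigma> \<in> admissible_dilatations0 L"
proof -
  define s where "s = (\<lambda>z. \<mu> * Moebius_function 0 a z)"
  define A where "A = complex_of_real (1 - (cmod a)\<^sup>2)"
  define h where "h = (\<lambda>z. (s z - s 0) / (\<mu> * A))"
  define g where "g = (\<lambda>z. ((s z)\<^sup>2 - (s 0)\<^sup>2) / (2 * (\<mu> * A)))"
  define f where "f = (\<lambda>z. h z + cnj (g z))"
  have \<mu>0: "\<mu> \<noteq> 0" using \<mu> by auto
  have A0: "A \<noteq> 0"
    using a unfolding A_def of_real_eq_0_iff by (simp add: abs_square_less_1 less_imp_neq[THEN not_sym])
  have nz: "1 - cnj a * z \<noteq> 0" if "z \<in> unit_disk" for z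
    using one_minus_cnj_mult_nonzero[OF a, of z] that by simp
  have ds: "(s has_field_derivative \<mu> * A / (1 - cnj a * z)\<^sup>2) (at z)" if z: "z \<in> unit_disk" for z
    using DERIV_cmult[OF Moebius_function_has_field_derivative[OF a, of z], of \<mu>] z
    by (simp add: s_def A_def del: of_real_diff)
  have dh: "(h has_field_derivative 1 / (1 - cnj a * z)\<^sup>2) (at z)" if z: "z \<in> unit_disk" for z
    unfolding h_def by (rule derivative_eq_intros ds[OF z] refl | use \<mu>0 A0 in simp)+
  have dg: "(g has_field_derivative s z / (1 - cnj a * z)\<^sup>2) (at z)" if z: "z \<in> unit_disk" for z
    unfolding g_def by (rule derivative_eq_intros ds[OF z] refl | use \<mu>0 A0 in simp)+
  have holh: "h holomorphic_on unit_disk" and holg: "g holomorphic_on unit_disk"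
    unfolding holomorphic_on_open[OF open_ball] using dh dg by blast+
  have h': "deriv h z = 1 / (1 - cnj a * z)\<^sup>2" and g': "deriv g z = s z / (1 - cnj a * z)\<^sup>2"
    if "z \<in> unit_disk" for z
    using dh[OF that] dg[OF that] by (auto intro: DERIV_imp_deriv)
  have dil: "dilatation h g z = s z" if "z \<in> unit_disk" for z
    using nz[OF that] by (simp add: dilatation_def h'[OF that] g'[OF that])
  have s1: "cmod (s z) < 1" if "z \<in> unit_disk" for z
    using Moebius_function_norm_lt_1[OF a, of z] that \<mu> by (simp add: s_def norm_mult)
  have sp: "sense_preserving h g"
    using nz s1 by (auto simp: sense_preserving_def dil h')
  have inv2: "((\<lambda>z. c / (1 - cnj a * z)\<^sup>2) has_field_derivative 2 * cnj a * c / (1 - cnj a * z) ^ 3) (at z)"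
    if z: "z \<in> unit_disk" for z c
  proof -
    define n where "n = 1 - cnj a * z"
    have n0: "n \<noteq> 0" using nz[OF z] by (simp add: n_def)
    have "((\<lambda>z. (1 - cnj a * z)\<^sup>2) has_field_derivative - 2 * cnj a * n) (at z)"
      unfolding n_def by (rule derivative_eq_intros refl | simp)+
    hence "((\<lambda>z. c / (1 - cnj a * z)\<^sup>2) has_field_derivative
        (0 * n\<^sup>2 - c * (- 2 * cnj a * n)) / (n\<^sup>2 * n\<^sup>2)) (at z)"
      using DERIV_divide[OF DERIV_const[of c]] n0 unfolding n_def by fastforce
    also have "(0 * n\<^sup>2 - c * (- 2 * cnj a * n)) / (n\<^sup>2 * n\<^sup>2) = 2 * cnj a * c / n ^ 3"
      using n0 by (simp add: field_simps power2_eq_square power3_eq_cube)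
    finally show ?thesis unfolding n_def .
  qed
  have h'': "deriv (deriv h) z = 2 * cnj a / (1 - cnj a * z) ^ 3" if z: "z \<in> unit_disk" for z
    using deriv_eq_on_disk[OF h' inv2[OF z, of 1] z] by simp
  have p: "pre_schwarzian h z = 2 * cnj a / (1 - cnj a * z)" if z: "z \<in> unit_disk" for z
  proof -
    define n where "n = 1 - cnj a * z"
    have "n \<noteq> 0" using nz[OF z] by (simp add: n_def)
    thus ?thesis
      unfolding pre_schwarzian_def h'[OF z] h''[OF z] n_def[symmetric]
      by (simp add: power2_eq_square power3_eq_cube)
  qed
  have p': "deriv (pre_schwarzian h) z = 2 * (cnj a)\<^sup>2 / (1 - cnj a * z)\<^sup>2" if z: "z \<in> unit_disk" for z
  proof (rule deriv_eq_on_disk[OF p _ z])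
    have "((\<lambda>z. 1 - cnj a * z) has_field_derivative - cnj a) (at z)"
      by (rule derivative_eq_intros refl | simp)+
    from DERIV_divide[OF DERIV_const[of "2 * cnj a"] this nz[OF z]]
    show "((\<lambda>z. 2 * cnj a / (1 - cnj a * z)) has_field_derivative 2 * (cnj a)\<^sup>2 / (1 - cnj a * z)\<^sup>2) (at z)"
      by (simp add: power2_eq_square mult.assoc)
  qed
  have S0: "schwarzian h z = 0" if z: "z \<in> unit_disk" for z
    unfolding schwarzian_def p'[OF z] p[OF z] power_divide power_mult_distrib by simp
  have w': "deriv (dilatation h g) z = \<mu> * A / (1 - cnj a * z)\<^sup>2" if z: "z \<in> unit_disk" for z
    by (rule deriv_eq_on_disk[OF dil ds[OF z] z])
  have w'': "deriv (deriv (dilatation h g)) z = 2 * cnj a * (\<mu> * A) / (1 - cnj a * z) ^ 3"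
    if z: "z \<in> unit_disk" for z
    by (rule deriv_eq_on_disk[OF w' inv2[OF z] z])
  have bound: "cmod (harmonic_schwarzian h g z) * (1 - (cmod z)\<^sup>2)\<^sup>2 \<le> 3 / 2" if z: "z \<in> unit_disk" for z
  proof -
    \<comment> \<open>Since \<open>h'\<close> is a constant multiple of \<open>\<omega>'\<close>, both have the same logarithmic derivative.\<close>
    have mid: "pre_schwarzian h z * deriv (dilatation h g) z - deriv (deriv (dilatation h g)) z = 0"
      unfolding p[OF z] w'[OF z] w''[OF z] by (simp add: power2_eq_square power3_eq_cube)
    define d where "d = 1 - (cmod (s z))\<^sup>2"
    have d: "0 < d" using s1[OF z] by (simp add: d_def abs_square_less_1)
    have z1: "cmod z < 1" using z by simp
    have "deriv (dilatation h g) z = \<mu> * deriv (Moebius_function 0 a) z"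
      using DERIV_imp_deriv[OF Moebius_function_has_field_derivative[OF a z1]] by (simp add: w'[OF z] A_def)
    hence n: "cmod (deriv (dilatation h g) z) * (1 - (cmod z)\<^sup>2) = d"
      using norm_deriv_Moebius[OF a z1] \<mu> by (simp add: norm_mult d_def s_def)
    have "harmonic_schwarzian h g z = - 3 / 2 * (deriv (dilatation h g) z * cnj (s z) / complex_of_real d)\<^sup>2"
      unfolding harmonic_schwarzian_def Let_def mid S0[OF z] dil[OF z] d_def[symmetric] by simp
    hence "cmod (harmonic_schwarzian h g z) = 3 / 2 * (cmod (deriv (dilatation h g) z) * cmod (s z) / d)\<^sup>2"
      using d by (simp add: norm_mult norm_power norm_divide)
    hence "cmod (harmonic_schwarzian h g z) * (1 - (cmod z)\<^sup>2)\<^sup>2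
        = 3 / 2 * ((cmod (deriv (dilatation h g) z) * (1 - (cmod z)\<^sup>2)) * cmod (s z) / d)\<^sup>2"
      by (simp add: power_mult_distrib power_divide)
    also have "\<dots> = 3 / 2 * (cmod (s z))\<^sup>2" unfolding n using d by simp
    also have "\<dots> \<le> 3 / 2 * 1" using s1[OF z] by (intro mult_left_mono) (auto simp: power_le_one)
    finally show ?thesis by simp
  qed
  have "schwarzian_norm h g \<le> ereal L"
    unfolding schwarzian_norm_def using bound L by (intro SUP_least) (force intro: order_trans)
  moreover have dec: "harmonic_decomposition f h g"
    using holh holg by (simp add: harmonic_decomposition_def f_def)
  ultimately have fam: "f \<in> harmonic_family L"
    using sp h'[of 0] unfolding harmonic_family_def by (force simp: h_def g_def)
  have dil\<sigma>: "\<forall>z\<in>unit_disk. \<sigma> z = dilatation h g z"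
    using dil \<sigma> by (simp add: s_def)
  show "\<sigma> \<in> admissible_dilatations L"
    unfolding admissible_dilatations_def dilatations_def using fam dec dil\<sigma> by blast
  assume "a = 0"
  hence "deriv g 0 = 0" using g'[of 0] by (simp add: s_def Moebius_function_simple)
  hence "f \<in> harmonic_family0 L"
    unfolding harmonic_family0_def using fam dec by blast
  thus "\<sigma> \<in> admissible_dilatations0 L"
    unfolding admissible_dilatations0_def dilatations_def using dec dil\<sigma> by blast
qed

text \<open>
  After moving the zero of \<open>\<sigma>\<close> to the origin, the Schwarz lemma applies to the automorphism and to
  its inverse, which forces equality at the test point \<open>1/2\<close> and hence a rotation.
\<close>

lemma disk_automorphism_eq_Moebius:
  assumes "disk_automorphism \<sigma>"
  obtains \<mu> a where "cmod \<mu> = 1" "cmod a < 1" "\<And>z. z \<in> unit_disk \<Longrightarrow> \<sigma> z = \<mu> * Moebius_function 0 a z"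
proof -
  define \<tau> where "\<tau> = inv_into unit_disk \<sigma>"
  have hol: "\<sigma> holomorphic_on unit_disk" "\<tau> holomorphic_on unit_disk" and bij: "bij_betw \<sigma> unit_disk unit_disk"
    using assms by (auto simp: disk_automorphism_def \<tau>_def)
  have \<sigma>D: "\<sigma> z \<in> unit_disk" and \<tau>D: "\<tau> z \<in> unit_disk" and inv: "\<tau> (\<sigma> z) = z" "\<sigma> (\<tau> z) = z"
    if "z \<in> unit_disk" for z
    using bij that bij_betw_apply[OF bij] bij_betw_apply[OF bij_betw_inv_into[OF bij]]
      bij_betw_inv_into_left[OF bij] bij_betw_inv_into_right[OF bij] by (auto simp: \<tau>_def)
  define a where "a = \<tau> 0"
  have a: "cmod a < 1" "cmod (-a) < 1" and \<sigma>a: "\<sigma> a = 0"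
    using \<tau>D[of 0] inv(2)[of 0] by (auto simp: a_def)
  let ?M = "Moebius_function 0 a" and ?N = "Moebius_function 0 (-a)"
  have MD: "?M z \<in> unit_disk" "?N z \<in> unit_disk" if "z \<in> unit_disk" for z
    using that a Moebius_function_norm_lt_1 by auto
  have NM: "?N (?M z) = z" "?M (?N z) = z" if "z \<in> unit_disk" for z
    using that a Moebius_function_compose[of "-a" a z] Moebius_function_compose[of a "-a" z] by auto
  have v: "(\<sigma> \<circ> ?N) holomorphic_on ball 0 1" "(\<sigma> \<circ> ?N) 0 = 0"
      "\<And>z. cmod z < 1 \<Longrightarrow> cmod ((\<sigma> \<circ> ?N) z) < 1"
    using MD \<sigma>D \<sigma>a
    by (auto intro!: holomorphic_on_compose_gen[OF Moebius_function_holomorphic[OF a(2)] hol(1)]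
        simp: Moebius_function_of_zero)
  have u: "(?M \<circ> \<tau>) holomorphic_on ball 0 1" "(?M \<circ> \<tau>) 0 = 0"
      "\<And>z. cmod z < 1 \<Longrightarrow> cmod ((?M \<circ> \<tau>) z) < 1"
    using MD \<tau>D
    by (auto intro!: holomorphic_on_compose_gen[OF hol(2) Moebius_function_holomorphic[OF a(1)]]
        simp: a_def[symmetric] Moebius_function_eq_zero)
  have half: "(1/2::complex) \<in> unit_disk" "cmod (1/2::complex) < 1" by auto
  have "cmod ((\<sigma> \<circ> ?N) (1/2)) \<le> cmod (1/2::complex)"
    by (rule Schwarz_Lemma(1)[OF v half(2)])
  moreover have "cmod ((?M \<circ> \<tau>) ((\<sigma> \<circ> ?N) (1/2))) \<le> cmod ((\<sigma> \<circ> ?N) (1/2))"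
    by (rule Schwarz_Lemma(1)[OF u v(3)[OF half(2)]])
  moreover have "(?M \<circ> \<tau>) ((\<sigma> \<circ> ?N) (1/2)) = 1/2"
    using inv(1)[OF MD(2)[OF half(1)]] NM(2)[OF half(1)] by simp
  ultimately have "cmod ((\<sigma> \<circ> ?N) (1/2)) = cmod (1/2::complex)"
    by (metis order_antisym)
  hence "\<exists>\<alpha>. (\<forall>z. cmod z < 1 \<longrightarrow> (\<sigma> \<circ> ?N) z = \<alpha> * z) \<and> cmod \<alpha> = 1"
    using half(2) by (intro Schwarz_Lemma(3)[OF v half(2)] disjI1 exI[of _ "1/2"]) auto
  then obtain \<mu> where \<mu>: "\<And>z. cmod z < 1 \<Longrightarrow> \<sigma> (?N z) = \<mu> * z" "cmod \<mu> = 1"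
    by auto
  show ?thesis
    by (rule that[OF \<mu>(2) a(1)]) (use \<mu>(1) MD(1) NM(1) in force)
qed

lemma disk_automorphism_ident: "disk_automorphism (\<lambda>z. z)"
proof -
  have "inv_into unit_disk (\<lambda>z. z) z = z" if "z \<in> unit_disk" for z
    using that by (intro inv_into_f_f) auto
  hence "inv_into unit_disk (\<lambda>z. z) holomorphic_on unit_disk"
    by (subst holomorphic_cong[OF refl, where g = "\<lambda>z. z"]) auto
  thus ?thesis by (auto simp: disk_automorphism_def bij_betw_def inj_on_def)
qed

section \<open>The equivalence\<close>

theorem theorem3:
  fixes L :: real
  assumes "L \<ge> 0"
  shows "(L \<ge> 3 / 2 \<longleftrightarrow> (\<exists>\<omega>\<in>admissible_dilatations0 L. cmod (deriv \<omega> 0) = 1)) \<and>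
    (L \<ge> 3 / 2 \<longleftrightarrow> {(\<lambda>z. \<mu> * z) |\<mu>. cmod \<mu> = 1} \<subseteq> admissible_dilatations0 L) \<and>
    (L \<ge> 3 / 2 \<longleftrightarrow> (\<forall>\<sigma>. disk_automorphism \<sigma> \<longrightarrow> \<sigma> \<in> admissible_dilatations L)) \<and>
    (L \<ge> 3 / 2 \<longleftrightarrow> (\<exists>\<omega>\<in>admissible_dilatations L. hyperbolic_norm \<omega> = 1))"
proof -
  have rot: "{(\<lambda>z. \<mu> * z) |\<mu>. cmod \<mu> = 1} \<subseteq> admissible_dilatations0 L" if "3 / 2 \<le> L"
    using that by (auto intro!: Moebius_admissible(2)[where a = 0] simp: Moebius_function_simple)
  have aut: "\<sigma> \<in> admissible_dilatations L" if "3 / 2 \<le> L" "disk_automorphism \<sigma>" for \<sigma>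
    using disk_automorphism_eq_Moebius[OF that(2)] Moebius_admissible(1)[OF _ _ that(1)] by metis
  have hyp_id: "cmod (hyperbolic_deriv (\<lambda>z. z) z) = 1" if "z \<in> unit_disk" for z
  proof -
    have "cmod z < 1" using that by simp
    moreover have "0 < 1 - (cmod z)\<^sup>2" using that by (simp add: abs_square_less_1)
    ultimately show ?thesis using cmod_hyperbolic_deriv[of z "\<lambda>z. z"] by simp
  qed
  hence norm_id: "hyperbolic_norm (\<lambda>z. z) = 1"
    by (simp add: hyperbolic_norm_def one_ereal_def)
  have v: "3 / 2 \<le> L" if "\<omega> \<in> admissible_dilatations L" "hyperbolic_norm \<omega> = 1" for \<omega>
  proof (rule three_halves_le_if_hyperbolic_deriv_near_1[OF that(1)])
    fix x :: real assume "x < 1"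
    hence "ereal x < hyperbolic_norm \<omega>" using that(2) by (simp add: one_ereal_def)
    thus "\<exists>z\<in>unit_disk. x < cmod (hyperbolic_deriv \<omega> z)"
      by (auto simp: hyperbolic_norm_def less_SUP_iff)
  qed
  have ii: "3 / 2 \<le> L" if "\<omega> \<in> admissible_dilatations0 L" "cmod (deriv \<omega> 0) = 1" for \<omega>
  proof (rule three_halves_le_if_hyperbolic_deriv_near_1)
    show "\<omega> \<in> admissible_dilatations L" using that(1) admissible_dilatations0_subset by blast
    have "cmod (hyperbolic_deriv \<omega> 0) = 1"
      using that(2) admissible_dilatation0_zero[OF that(1)] by (simp add: hyperbolic_deriv_def)
    thus "\<exists>z\<in>unit_disk. x < cmod (hyperbolic_deriv \<omega> z)" if "x < 1" for x
      using that by (intro bexI[of _ 0]) auto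
  qed
  have id_rot: "(\<lambda>z::complex. z) \<in> {(\<lambda>z. \<mu> * z) |\<mu>. cmod \<mu> = 1}"
    by (intro CollectI exI[of _ 1]) auto
  have iii: "3 / 2 \<le> L" if "{(\<lambda>z. \<mu> * z) |\<mu>. cmod \<mu> = 1} \<subseteq> admissible_dilatations0 L"
    using that id_rot by (intro ii[of "\<lambda>z. z"]) auto
  have iv: "3 / 2 \<le> L" if "\<forall>\<sigma>. disk_automorphism \<sigma> \<longrightarrow> \<sigma> \<in> admissible_dilatations L"
    using that disk_automorphism_ident norm_id by (intro v[of "\<lambda>z. z"]) auto
  have "(\<lambda>z::complex. z) \<in> admissible_dilatations0 L" if "3 / 2 \<le> L"
    using rot[OF that] id_rot by blast
  hence "3 / 2 \<le> L \<Longrightarrow> \<exists>\<omega>\<in>admissible_dilatations0 L. cmod (deriv \<omega> 0) = 1"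
    by (intro bexI[of _ "\<lambda>z. z"]) auto
  moreover have "3 / 2 \<le> L \<Longrightarrow> \<exists>\<omega>\<in>admissible_dilatations L. hyperbolic_norm \<omega> = 1"
    using aut[OF _ disk_automorphism_ident] norm_id by blast
  ultimately show ?thesis
    using rot aut ii iii iv v by blast
qed

end
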